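(* Let $X=(\mathbb{Z}/2\mathbb{Z})^{\mathbb{N}_0}$ and let $T\colon X\to X$ be the one-sided shift. Then there exist rational numbers $c_k\in\mathbb{Q}$ ($k\ge1$) and a function $\widetilde F\in C(X,\mathbb{R})$ of the form $$\widetilde F(x)=\sum_{k=1}^{+\infty}c_k w_k(x),$$ where $w_k$ is the $k$-th Walsh function, such that the partial sums $\sum_{k=1}^{K}c_kw_k$ of the Walsh--Fourier series converge uniformly to $\widetilde F$ on $X$ as $K\to+\infty$, and the $(1/2,1/2)$-Bernoulli measure is the unique $T$-invariant maximizing measure for $\widetilde F$. Moreover, each coefficient $c_k$ is determined exactly by a finite procedure.
   Context: $\mathbb{N}_0=\{0,1,2,\dots\}$; $X$ carries the product topology and the shift is $(Tx)_j=x_{j+1}$. For $k\in\mathbb{N}_0$ write $k=\sum_{j\ge0}\varepsilon_j(k)2^j$ with $\varepsilon_j(k)\in\{0,1\}$ (binary expansion). For $x=(x_j)_{j\ge0}\in X$, the $k$-th Walsh function is $w_k(x)=(-1)^{\sum_{j\ge0}\varepsilon_j(k)x_j}$. A $T$-invariant Borel probability measure $\mu$ is called maximizing for $f\in C(X,\mathbb{R})$ if $\int f\,\mathrm{d}\mu=\sup_{\nu}\int f\,\mathrm{d}\nu$, the supremum being over all $T$-invariant Borel probability measures $\nu$ on $X$. "Each $c_k$ is determined exactly by a finite procedure" means: there is an algorithm which, given $k$, returns the exact value of the rational number $c_k$ (not merely an approximation) after finitely many arithmetic operations. *)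

theory Defs
  imports "HOL-Probability.Probability"
begin

section \<open>The full one-sided shift on two symbols\<close>

text \<open>
  The space \<open>(Z/2Z)\<^sup>\<nat>\<close> is the type \<^typ>\<open>nat \<Rightarrow> bool\<close>, with \<^const>\<open>False\<close> and \<^const>\<open>True\<close>
  standing for the residues \<open>0\<close> and \<open>1\<close>.  Its topology is the product of the discrete topologies,
  and \<^const>\<open>borel\<close> is the corresponding Borel sigma-algebra.
\<close>

definition shift :: "(nat \<Rightarrow> bool) \<Rightarrow> (nat \<Rightarrow> bool)" where
  "shift x = (\<lambda>j. x (Suc j))"

text \<open>The binary digit \<open>\<epsilon>\<^sub>j(k)\<close> is \<^term>\<open>of_bool (bit k j) :: nat\<close>.\<close>

definition walsh :: "nat \<Rightarrow> (nat \<Rightarrow> bool) \<Rightarrow> real" where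
  "walsh k x = (- 1) ^ (\<Sum>j | bit k j. of_bool (x j))"

lemma bit_less: "bit (k::nat) j \<Longrightarrow> j < k"
proof -
  assume "bit k j"
  then have "k div 2 ^ j \<noteq> 0" by (auto simp: bit_iff_odd intro!: Nat.gr0I)
  then have "2 ^ j \<le> k" by (simp add: div_eq_0_iff)
  with less_exp[of j] show "j < k" by (rule order_less_le_trans)
qed

lemma finite_bits: "finite {j. bit (k::nat) j}"
  by (rule finite_subset[of _ "{..<k}"]) (auto dest: bit_less)

lemma binary_expansion: "(k::nat) = (\<Sum>j | bit k j. 2 ^ j)"
proof -
  have "k = take_bit k k" by (simp add: take_bit_eq_mod)
  also have "\<dots> = (\<Sum>j<k. of_bool (bit k j) * 2 ^ j)"
    by (simp flip: horner_sum_bit_eq_take_bit add: horner_sum_eq_sum lessThan_atLeast0)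
  also have "\<dots> = (\<Sum>j | bit k j. 2 ^ j)"
    by (rule sum.mono_neutral_cong_right) (auto dest: bit_less)
  finally show ?thesis .
qed

section \<open>Invariant and maximizing measures\<close>

definition invariant_measures :: "(nat \<Rightarrow> bool) measure set" where
  "invariant_measures =
     {\<mu>. prob_space \<mu> \<and> sets \<mu> = sets borel \<and> distr \<mu> borel shift = \<mu>}"

text \<open>
  For continuous \<open>f\<close> the supremum below is that of a nonempty bounded set of reals, because
  \<^typ>\<open>nat \<Rightarrow> bool\<close> is compact and \<open>invariant_measures\<close> is nonempty.
\<close>

definition maximizing :: "((nat \<Rightarrow> bool) \<Rightarrow> real) \<Rightarrow> (nat \<Rightarrow> bool) measure \<Rightarrow> bool" where
  "maximizing f \<mu> \<longleftrightarrow>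
     \<mu> \<in> invariant_measures \<and>
     integral\<^sup>L \<mu> f = (SUP \<nu>\<in>invariant_measures. integral\<^sup>L \<nu> f)"

instance bool :: second_countable_topology
proof
  show "\<exists>B::bool set set. countable B \<and> open = generate_topology B"
    unfolding open_bool_def by (intro exI conjI, rule countable_finite) auto
qed

definition bernoulli_half :: "(nat \<Rightarrow> bool) measure" where
  "bernoulli_half = PiM UNIV (\<lambda>_. measure_pmf (bernoulli_pmf (1 / 2)))"

lemma measurable_shift: "shift \<in> borel \<rightarrow>\<^sub>M borel"
  unfolding shift_def
  by (intro borel_measurable_continuous_onI continuous_on_coordinatewise_then_product
        continuous_on_product_coordinates)

lemma sets_bernoulli_half: "sets bernoulli_half = sets borel"
proof -
  have "sets bernoulli_half = sets (PiM (UNIV :: nat set) (\<lambda>_. borel :: bool measure))"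
    unfolding bernoulli_half_def
    by (intro sets_PiM_cong) (simp_all add: sets_borel_eq_count_space)
  then show ?thesis by (simp add: sets_PiM_equal_borel)
qed

lemma bernoulli_half_invariant: "bernoulli_half \<in> invariant_measures"
proof -
  have meas: "PiM UNIV (\<lambda>_. measure_pmf (bernoulli_pmf (1 / 2))) = bernoulli_half"
    by (simp add: bernoulli_half_def)
  have "distr bernoulli_half borel shift = distr bernoulli_half bernoulli_half shift"
    by (rule distr_cong) (simp_all add: sets_bernoulli_half)
  also have "\<dots> = distr (PiM UNIV (\<lambda>_. measure_pmf (bernoulli_pmf (1 / 2))))
      (PiM UNIV (\<lambda>_. measure_pmf (bernoulli_pmf (1 / 2)))) (\<lambda>x. \<lambda>j\<in>UNIV. x (Suc j))"
    unfolding meas by (simp add: shift_def[abs_def] restrict_def)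
  also have "\<dots> = bernoulli_half"
    unfolding bernoulli_half_def
    by (subst distr_PiM_reindex) (auto intro: measure_pmf.prob_space_axioms)
  finally have "distr bernoulli_half borel shift = bernoulli_half" .
  moreover have "prob_space bernoulli_half"
    unfolding bernoulli_half_def by (intro prob_space_PiM measure_pmf.prob_space_axioms)
  ultimately show ?thesis
    by (simp add: invariant_measures_def sets_bernoulli_half)
qed

section \<open>Computable sequences of rationals\<close>

text \<open>
  \<open>recursive n f\<close>: the \<open>n\<close>-ary function \<open>f\<close> is general recursive.  Arguments are passed as a list
  of length \<open>n\<close>; values of \<open>f\<close> on lists of any other length are irrelevant.  Minimization is
  restricted to regular functions, so exactly the total computable functions arise.
\<close>

inductive recursive :: "nat \<Rightarrow> (nat list \<Rightarrow> nat) \<Rightarrow> bool" where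
  zero: "recursive n (\<lambda>_. 0)"
| succ: "recursive 1 (\<lambda>xs. Suc (xs ! 0))"
| proj: "i < n \<Longrightarrow> recursive n (\<lambda>xs. xs ! i)"
| comp: "recursive m f \<Longrightarrow> length gs = m \<Longrightarrow> \<forall>g\<in>set gs. recursive n g \<Longrightarrow>
    recursive n (\<lambda>xs. f (map (\<lambda>g. g xs) gs))"
| prim_rec: "recursive n f \<Longrightarrow> recursive (Suc (Suc n)) h \<Longrightarrow>
    recursive (Suc n) (\<lambda>xs. rec_nat (f (tl xs)) (\<lambda>y r. h (y # r # tl xs)) (hd xs))"
| minim: "recursive (Suc n) g \<Longrightarrow> \<forall>xs. length xs = n \<longrightarrow> (\<exists>y. g (y # xs) = 0) \<Longrightarrow>
    recursive n (\<lambda>xs. LEAST y. g (y # xs) = 0)"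

text \<open>
  A single algorithm, uniform in \<open>k\<close>, outputs the exact value of \<open>c k\<close> as a quotient of an integer
  \<open>p - q\<close> by a nonzero natural number \<open>d\<close>.
\<close>

definition computable_rat_seq :: "(nat \<Rightarrow> rat) \<Rightarrow> bool" where
  "computable_rat_seq c \<longleftrightarrow>
     (\<exists>p q d. recursive 1 p \<and> recursive 1 q \<and> recursive 1 d \<and>
       (\<forall>k. d [k] \<noteq> 0 \<and> c k = (of_nat (p [k]) - of_nat (q [k])) / of_nat (d [k])))"

end

theory Submission
  imports Defs "HOL-Library.Discrete_Functions" "HOL-Real_Asymp.Real_Asymp"
begin

text \<open>
  Write \<open>B\<close> for the Bernoulli measure.  The function \<open>F\<close> is \<open>- potential\<close>, where \<open>potential\<close> is
  continuous, has integral \<open>0\<close> with respect to \<open>B\<close>, and has a strictly positive integral with respect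
  to every other invariant measure.

  \<^bold>\<open>The potential.\<close>  It is built from functions \<open>stage j\<close> with values in \<open>[0, 1]\<close>, each depending on
  finitely many coordinates and starting with \<open>stage 0 = 0\<close>.  The next stage is obtained from \<open>stage j\<close> by averaging over many
  disjoint blocks, adding \<open>2^-(j+1)\<close> times the amount by which the frequency of one word in these
  blocks exceeds its \<open>B\<close>-probability, subtracting \<open>4^-(j+1)\<close>, and taking the positive part.  Three
  things happen.

  \<^item> Averaging over shifts changes no integral against an invariant measure, and apart from it the
    step changes the function by at most \<open>2^-(j+1)\<close>.  Hence the integrals of the stages converge
    uniformly over all invariant measures.  The differences \<open>increment j\<close> between \<open>stage (j+1)\<close> and
    the averaged \<open>stage j\<close> sum up uniformly to a continuous function whose integral against each
    invariant measure is the limit of the integrals of the stages.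
  \<^item> Under \<open>B\<close> disjoint blocks are independent, so the averages have variance at most one over the
    number of blocks, which is chosen so large that the subtraction of \<open>4^-(j+1)\<close> removes almost
    everything: the mean of \<open>stage j\<close> is at most half of \<open>4^-(j+1)\<close>
    (\<open>mean_stage_le\<close>), hence the limit is \<open>0\<close>.
  \<^item> An invariant measure other than \<open>B\<close> gives some word too large a probability
    (\<open>exists_frequent_cylinder\<close>).  Every word is tested at infinitely many stages.  Since
    \<open>2^-(j+1)\<close> is eventually much larger than \<open>4^-(j+1)\<close>, some test of this word lifts the integral
    by more than all later subtractions together can remove, and the limit is positive
    (\<open>integral_stage_eventually_positive\<close>).

  \<^bold>\<open>The Walsh series.\<close>  The partial sums up to a power of two are conditional expectations, which
  converge uniformly for this potential.  It remains to make the sums of the absolute values of the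
  coefficients over the blocks \<open>2^s \<le> k < 2^(s+1)\<close> tend to \<open>0\<close>.  Composition with the shift
  turns \<open>w_k\<close> into \<open>w_(2k)\<close>, so it moves each frequency from one such block to the next.
  Therefore \<open>increment j\<close> is replaced by an average of its shifts of orders \<open>j, j+1, ...\<close>.  Invariant
  integrals stay the same, but the coefficients get divided by the number of shifts while each
  frequency enters a given block for at most one of them.  So this summand of the potential
  contributes at most \<open>2^-(j+1)\<close> to each block sum (\<open>dyadic_block_sum_le\<close>), and nothing to all but
  finitely many of them.

  \<^bold>\<open>Computability.\<close>  Since the shifts of \<open>increment j\<close> start at order \<open>j\<close>, all its frequencies are
  \<open>0\<close> or at least \<open>2^j\<close>, so that only the increments \<open>j < k\<close> contribute to \<open>c_k\<close>.  The contribution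
  of each is a finite average of rational values.  The recursion for the stages, after clearing
  denominators, lives on natural numbers; it is carried out on tables of values coded as the digits
  of one number, which makes it an instance of primitive recursion.
\<close>

section \<open>Functions of finitely many coordinates\<close>

lemma funpow_shift: "(shift ^^ m) x i = x (i + m)"
  by (induction m arbitrary: i) (auto simp: shift_def)

lemma shift_bit: "(shift ^^ m) (bit (u::nat)) = bit (u div 2 ^ m)"
  by (rule ext) (simp add: funpow_shift bit_iff_odd flip: div_mult2_eq power_add mult.commute add.commute)

text \<open>
  Functions of the first \<open>N\<close> coordinates are the finite combinatorial objects behind the whole
  construction.  Their values are sampled at the points \<open>bit u\<close> with \<open>u < 2^N\<close>, the binary digits of
  a number being read as a sequence that is eventually \<open>False\<close>.
\<close>

definition depends_on :: "nat \<Rightarrow> ((nat \<Rightarrow> bool) \<Rightarrow> 'a) \<Rightarrow> bool" where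
  "depends_on N f \<longleftrightarrow> (\<forall>x y. (\<forall>i<N. x i = y i) \<longrightarrow> f x = f y)"

lemma depends_onD: "depends_on N f \<Longrightarrow> (\<And>i. i < N \<Longrightarrow> x i = y i) \<Longrightarrow> f x = f y"
  unfolding depends_on_def by blast

lemma depends_on_mono:
  assumes "depends_on N f" "N \<le> M" shows "depends_on M f"
  unfolding depends_on_def
proof (intro allI impI)
  fix x y :: "nat \<Rightarrow> bool" assume "\<forall>i<M. x i = y i"
  then show "f x = f y" using assms(2) by (intro depends_onD[OF assms(1)]) simp
qed

lemma depends_on_const: "depends_on N (\<lambda>_. c)"
  unfolding depends_on_def by blast

lemma depends_on_map: "depends_on N f \<Longrightarrow> depends_on N (\<lambda>x. h (f x))"
  unfolding depends_on_def by metis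

lemma depends_on_map2: "depends_on N f \<Longrightarrow> depends_on N g \<Longrightarrow> depends_on N (\<lambda>x. h (f x) (g x))"
  unfolding depends_on_def by metis

lemma depends_on_sum:
  assumes "\<And>i. i \<in> I \<Longrightarrow> depends_on N (f i)"
  shows "depends_on N (\<lambda>x. \<Sum>i\<in>I. f i x)"
  using assms unfolding depends_on_def by (metis (no_types, lifting) sum.cong)

lemma depends_on_shift:
  assumes "depends_on N f" shows "depends_on (N + m) (\<lambda>x. f ((shift ^^ m) x))"
  unfolding depends_on_def
proof (intro allI impI)
  fix x y :: "nat \<Rightarrow> bool" assume *: "\<forall>i<N + m. x i = y i"
  show "f ((shift ^^ m) x) = f ((shift ^^ m) y)"
    by (rule depends_onD[OF assms]) (use * in \<open>simp add: funpow_shift\<close>)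
qed

definition cylinder :: "nat \<Rightarrow> nat \<Rightarrow> (nat \<Rightarrow> bool) set" where
  "cylinder N u = {x. \<forall>i<N. x i = bit u i}"

definition prefix_code :: "nat \<Rightarrow> (nat \<Rightarrow> bool) \<Rightarrow> nat" where
  "prefix_code N x = horner_sum of_bool 2 (map x [0..<N])"

lemma bit_prefix_code: "bit (prefix_code N x) i \<longleftrightarrow> i < N \<and> x i"
  by (auto simp: prefix_code_def bit_horner_sum_bit_iff)

lemma prefix_code_less: "prefix_code N x < 2 ^ N"
proof -
  have "take_bit N (prefix_code N x) = prefix_code N x"
    by (rule bit_eqI) (auto simp: bit_take_bit_iff bit_prefix_code)
  then show ?thesis by (metis take_bit_nat_less_exp)
qed

lemma in_cylinder_iff_prefix_code:
  assumes "u < 2 ^ N" shows "x \<in> cylinder N u \<longleftrightarrow> u = prefix_code N x"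
proof
  assume x: "x \<in> cylinder N u"
  have u: "take_bit N u = u" using assms by (simp add: take_bit_nat_eq_self)
  show "u = prefix_code N x"
  proof (rule bit_eqI)
    fix i
    have "bit u i \<longleftrightarrow> i < N \<and> bit u i" by (metis bit_take_bit_iff u)
    then show "bit u i \<longleftrightarrow> bit (prefix_code N x) i" using x by (auto simp: bit_prefix_code cylinder_def)
  qed
qed (simp add: cylinder_def bit_prefix_code)

text \<open>
  Each point lies in exactly one of the \<open>2^N\<close> cylinders of length \<open>N\<close>, namely the one whose
  number is its prefix code.
\<close>

lemma depends_on_expand:
  fixes f :: "(nat \<Rightarrow> bool) \<Rightarrow> real"
  assumes "depends_on N f"
  shows "f x = (\<Sum>u<(2::nat) ^ N. f (bit u) * indicator (cylinder N u) x)"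
proof -
  have "(\<Sum>u<(2::nat) ^ N. f (bit u) * indicator (cylinder N u) x) = (\<Sum>u<(2::nat) ^ N. if u = prefix_code N x then f (bit u) else 0)"
    by (intro sum.cong) (auto simp: in_cylinder_iff_prefix_code)
  also have "\<dots> = f (bit (prefix_code N x))" by (simp add: prefix_code_less)
  also have "\<dots> = f x" by (rule depends_onD[OF assms]) (simp add: bit_prefix_code)
  finally show ?thesis by simp
qed

lemma open_bool_singleton: "open {b :: bool}"
proof -
  have "{b} = (if b then {False<..} else {..<True})" by auto
  then show ?thesis by (metis open_greaterThan open_lessThan)
qed

lemma open_agree: "open {y :: nat \<Rightarrow> bool. \<forall>i<N. y i = x i}"
proof -
  have "open (\<Inter>i<N. (\<lambda>y :: nat \<Rightarrow> bool. y i) -` {x i})"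
    by (intro open_INT ballI open_vimage open_bool_singleton continuous_on_product_coordinates) auto
  also have "(\<Inter>i<N. (\<lambda>y :: nat \<Rightarrow> bool. y i) -` {x i}) = {y. \<forall>i<N. y i = x i}" by auto
  finally show ?thesis .
qed

lemma cylinder_sets: "cylinder N u \<in> sets borel"
  unfolding cylinder_def by (intro borel_open open_agree)

lemma depends_on_continuous:
  fixes f :: "(nat \<Rightarrow> bool) \<Rightarrow> real"
  assumes "depends_on N f" shows "continuous_on UNIV f"
proof -
  have "(f \<longlongrightarrow> f x) (at x)" for x
  proof (rule tendsto_eventually, unfold eventually_at_topological, intro exI conjI ballI impI)
    show "open {y. \<forall>i<N. y i = x i}" by (rule open_agree)
  next
    fix y assume "y \<in> {y. \<forall>i<N. y i = x i}"
    then show "f y = f x" by (intro depends_onD[OF assms]) auto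
  qed simp
  then show ?thesis by (simp add: continuous_on_def)
qed

lemma depends_on_measurable:
  fixes f :: "(nat \<Rightarrow> bool) \<Rightarrow> real"
  assumes "depends_on N f" "sets \<mu> = sets borel" shows "f \<in> borel_measurable \<mu>"
  using borel_measurable_continuous_onI[OF depends_on_continuous[OF assms(1)]]
  by (simp add: measurable_cong_sets[OF assms(2) refl])

lemma integral_depends_on:
  fixes f :: "(nat \<Rightarrow> bool) \<Rightarrow> real"
  assumes "prob_space \<mu>" and s: "sets \<mu> = sets borel" and f: "depends_on N f"
  shows "integrable \<mu> f" "integral\<^sup>L \<mu> f = (\<Sum>u<(2::nat) ^ N. f (bit u) * measure \<mu> (cylinder N u))"
proof -
  interpret prob_space \<mu> by fact
  have eq: "f = (\<lambda>x. \<Sum>u<(2::nat) ^ N. f (bit u) * indicator (cylinder N u) x)"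
    using depends_on_expand[OF f] by blast
  have c: "cylinder N u \<in> sets \<mu>" for u using cylinder_sets s by simp
  then have i: "integrable \<mu> (indicator (cylinder N u) :: _ \<Rightarrow> real)" for u
    by (simp add: emeasure_eq_measure)
  show "integrable \<mu> f"
    by (subst eq) (intro Bochner_Integration.integrable_sum integrable_mult_right i)
  have "integral\<^sup>L \<mu> f = (\<Sum>u<(2::nat) ^ N. f (bit u) * (\<integral>x. indicator (cylinder N u) x \<partial>\<mu>))"
    by (subst eq, subst Bochner_Integration.integral_sum)
       (auto intro!: integrable_mult_right i simp del: mult_indicator_subset)
  then show "integral\<^sup>L \<mu> f = (\<Sum>u<(2::nat) ^ N. f (bit u) * measure \<mu> (cylinder N u))"
    using c sets.sets_into_space by (auto simp: Int_absorb2)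
qed

lemma in_prod_emb_iff:
  "x \<in> prod_emb UNIV (\<lambda>_. measure_pmf p) J (PiE J A) \<longleftrightarrow> (\<forall>i\<in>J. x i \<in> A i)"
  by (subst prod_emb_PiE) (auto simp: PiE_iff split: if_splits)

lemma measure_bernoulli_cylinder: "measure bernoulli_half (cylinder N u) = 1 / 2 ^ N"
proof -
  let ?M = "\<lambda>_ :: nat. measure_pmf (bernoulli_pmf (1 / 2))"
  interpret product_prob_space ?M UNIV
    by (intro product_prob_spaceI measure_pmf.prob_space_axioms)
  have "cylinder N u = prod_emb UNIV ?M {..<N} (PiE {..<N} (\<lambda>i. {bit u i}))"
    by (intro set_eqI) (auto simp: cylinder_def in_prod_emb_iff)
  then have "measure bernoulli_half (cylinder N u) = (\<Prod>i<N. measure (?M i) {bit u i})"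
    unfolding bernoulli_half_def by (simp add: measure_PiM_emb)
  also have "\<dots> = (\<Prod>i<N. 1 / 2)"
    by (intro prod.cong) (auto simp: measure_pmf_single pmf_bernoulli_half)
  finally show ?thesis by (simp add: power_one_over)
qed

abbreviation mean :: "((nat \<Rightarrow> bool) \<Rightarrow> real) \<Rightarrow> real" where
  "mean f \<equiv> integral\<^sup>L bernoulli_half f"

lemma prob_space_bernoulli_half: "prob_space bernoulli_half"
  using bernoulli_half_invariant by (simp add: invariant_measures_def)

lemmas integrable_bernoulli = integral_depends_on(1)[OF prob_space_bernoulli_half sets_bernoulli_half]

text \<open>
  All integrals with respect to the Bernoulli measure that are computed exactly reduce to this finite
  average.
\<close>

lemma mean_eq:
  assumes "depends_on N f" shows "mean f = (\<Sum>u<(2::nat) ^ N. f (bit u)) / 2 ^ N"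
  by (simp add: integral_depends_on(2)[OF prob_space_bernoulli_half sets_bernoulli_half assms]
      measure_bernoulli_cylinder sum_divide_distrib)

lemma mean_indicator_cylinder: "mean (indicator (cylinder N u)) = 1 / 2 ^ N"
  using measure_bernoulli_cylinder[of N u] cylinder_sets[of N u]
    sets.sets_into_space[of "cylinder N u" bernoulli_half] by (auto simp: Int_absorb2 sets_bernoulli_half)

text \<open>
  This is the independence of disjoint blocks of coordinates.  In terms of finite averages: writing
  \<open>u = a + b * 2^N\<close>, the first factor sees only the lower digits \<open>a\<close> and the second only \<open>b\<close>.
\<close>

lemma mean_mult_shift:
  assumes f: "depends_on N f" and g: "depends_on K g"
  shows "mean (\<lambda>x. f x * g ((shift ^^ N) x)) = mean f * mean g"
proof -
  have "depends_on (K + N) (\<lambda>x. f x * g ((shift ^^ N) x))"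
    using depends_on_mono[OF f, of "K + N"] depends_on_shift[OF g, of N]
    by (intro depends_on_map2[where h="(*)"]) auto
  then have "mean (\<lambda>x. f x * g ((shift ^^ N) x))
      = (\<Sum>u<(2::nat) ^ K * 2 ^ N. f (bit u) * g (bit (u div 2 ^ N))) / 2 ^ (K + N)"
    by (simp add: mean_eq shift_bit power_add)
  also have "(\<Sum>u<(2::nat) ^ K * 2 ^ N. f (bit u) * g (bit (u div 2 ^ N)))
      = (\<Sum>b<(2::nat) ^ K. \<Sum>u\<in>{b * 2 ^ N..<b * 2 ^ N + (2::nat) ^ N}. f (bit u) * g (bit (u div 2 ^ N)))"
    by (rule sum.nat_group[symmetric])
  also have "\<dots> = (\<Sum>b<(2::nat) ^ K. \<Sum>a<(2::nat) ^ N. f (bit a) * g (bit b))"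
  proof (rule sum.cong[OF refl])
    fix b
    have "(\<Sum>u\<in>{b * 2 ^ N..<b * 2 ^ N + (2::nat) ^ N}. f (bit u) * g (bit (u div 2 ^ N)))
        = (\<Sum>a\<in>{0..<2 ^ N}. f (bit (a + b * 2 ^ N)) * g (bit ((a + b * 2 ^ N) div 2 ^ N)))"
      using sum.shift_bounds_nat_ivl[of "\<lambda>u. f (bit u) * g (bit (u div 2 ^ N))" 0 "b * 2 ^ N" "2 ^ N"]
      by (simp only: add_0 add.commute[of "2 ^ N" "b * 2 ^ N"])
    also have "\<dots> = (\<Sum>a<(2::nat) ^ N. f (bit a) * g (bit b))"
    proof (rule sum.cong)
      fix a :: nat assume "a \<in> {..<2 ^ N}"
      then have a: "a < 2 ^ N" by simp
      have "f (bit (a + b * 2 ^ N)) = f (bit a)"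
      proof (rule depends_onD[OF f])
        fix i assume "i < N"
        have "bit (take_bit N (a + b * 2 ^ N)) i = bit (take_bit N a) i"
          by (simp add: take_bit_eq_mod)
        then show "bit (a + b * 2 ^ N) i = bit a i"
          using \<open>i < N\<close> by (simp add: bit_take_bit_iff)
      qed
      then show "f (bit (a + b * 2 ^ N)) * g (bit ((a + b * 2 ^ N) div 2 ^ N)) = f (bit a) * g (bit b)"
        using a by simp
    qed auto
    finally show "(\<Sum>u\<in>{b * 2 ^ N..<b * 2 ^ N + (2::nat) ^ N}. f (bit u) * g (bit (u div 2 ^ N)))
        = (\<Sum>a<(2::nat) ^ N. f (bit a) * g (bit b))" .
  qed
  also have "\<dots> / 2 ^ (K + N) = mean f * mean g"
    by (simp add: mean_eq[OF f] mean_eq[OF g] power_add sum_product sum.swap[of _ _ "{..<(2::nat) ^ K}"])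
  finally show ?thesis .
qed

lemma integral_shift:
  assumes \<mu>: "\<mu> \<in> invariant_measures" and f: "f \<in> borel_measurable borel"
  shows "(\<integral>x. f ((shift ^^ m) x) \<partial>\<mu>) = integral\<^sup>L \<mu> (f :: _ \<Rightarrow> real)"
proof (induction m)
  case (Suc m)
  have s: "sets \<mu> = sets borel" and d: "distr \<mu> borel shift = \<mu>"
    using \<mu> by (auto simp: invariant_measures_def)
  have sh: "shift ^^ m \<in> borel \<rightarrow>\<^sub>M borel"
  proof (induction m)
    case (Suc m)
    then show ?case using measurable_comp[OF Suc measurable_shift] by (simp only: funpow.simps)
  qed simp
  have g: "(\<lambda>x. f ((shift ^^ m) x)) \<in> borel_measurable borel"
    using measurable_comp[OF sh f] by (simp add: comp_def)
  have "(\<integral>x. f ((shift ^^ m) x) \<partial>\<mu>) = (\<integral>x. f ((shift ^^ m) x) \<partial>distr \<mu> borel shift)"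
    by (simp add: d)
  also have "\<dots> = (\<integral>x. f ((shift ^^ m) (shift x)) \<partial>\<mu>)"
    by (rule integral_distr[OF _ g]) (simp add: measurable_cong_sets[OF s refl] measurable_shift)
  finally show ?case using Suc.IH by (simp add: funpow_swap1)
qed simp

lemma integrable_bounded:
  assumes "prob_space \<mu>" "sets \<mu> = sets borel" "f \<in> borel_measurable borel" "\<And>x. \<bar>f x\<bar> \<le> C"
  shows "integrable \<mu> (f :: _ \<Rightarrow> real)"
proof -
  interpret prob_space \<mu> by fact
  show ?thesis
    using assms by (intro integrable_const_bound[where B=C]) (auto simp: measurable_cong_sets[OF assms(2) refl])
qed

lemma abs_integral_le:
  assumes "prob_space \<mu>" "sets \<mu> = sets borel" "f \<in> borel_measurable borel" "\<And>x. \<bar>f x\<bar> \<le> C"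
  shows "\<bar>integral\<^sup>L \<mu> (f :: _ \<Rightarrow> real)\<bar> \<le> C"
proof -
  interpret prob_space \<mu> by fact
  have i: "integrable \<mu> f" by (rule integrable_bounded[OF assms])
  have "\<bar>integral\<^sup>L \<mu> f\<bar> \<le> (\<integral>x. \<bar>f x\<bar> \<partial>\<mu>)" by (rule integral_abs_bound)
  also have "\<dots> \<le> (\<integral>x. C \<partial>\<mu>)" using i assms(4) by (intro integral_mono) auto
  finally show ?thesis by (simp add: prob_space)
qed

text \<open>
  Every finite-dimensional event is a finite union of cylinders of one common length, and these events
  generate the Borel sigma-algebra.
\<close>

lemma eq_bernoulli_halfI:
  assumes p: "prob_space \<mu>" "sets \<mu> = sets borel"
    and c: "\<And>N u. u < 2 ^ N \<Longrightarrow> measure \<mu> (cylinder N u) = 1 / 2 ^ N"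
  shows "\<mu> = bernoulli_half"
proof -
  let ?M = "\<lambda>_ :: nat. measure_pmf (bernoulli_pmf (1 / 2))"
  interpret \<mu>: prob_space \<mu> by fact
  interpret B: prob_space bernoulli_half by (rule prob_space_bernoulli_half)
  have sp: "sets bernoulli_half = sets (PiM UNIV ?M)" by (simp add: bernoulli_half_def)
  have s\<mu>: "sets \<mu> = sets (PiM UNIV ?M)" using p(2) sets_bernoulli_half sp by simp
  show ?thesis
  proof (rule measure_eqI_PiM_infinite[OF s\<mu> sp])
    fix A :: "nat \<Rightarrow> bool set" and J :: "nat set"
    assume J: "finite J"
    let ?X = "prod_emb UNIV ?M J (PiE J A)"
    obtain N where N: "J \<subseteq> {..<N}" using finite_nat_iff_bounded J by auto
    have "x \<in> ?X \<longleftrightarrow> (\<forall>i\<in>J. x i \<in> A i)" for x :: "nat \<Rightarrow> bool"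
      by (rule in_prod_emb_iff)
    then have d: "depends_on N (indicator ?X :: _ \<Rightarrow> real)"
      using N unfolding depends_on_def indicator_def by (auto simp: subset_iff)
    have "?X \<in> sets (PiM UNIV ?M)"
      using J by (intro sets_PiM_I) auto
    then have m: "?X \<in> sets \<mu>" "?X \<in> sets bernoulli_half" using s\<mu> sp by auto
    have "measure \<mu> ?X = integral\<^sup>L \<mu> (indicator ?X)" 
      using m sets.sets_into_space by (auto simp: Int_absorb2)
    also have "\<dots> = (\<Sum>u<(2::nat) ^ N. indicator ?X (bit u) * (1 / 2 ^ N))"
      unfolding integral_depends_on(2)[OF p d] by (intro sum.cong) (auto simp: c)
    also have "\<dots> = mean (indicator ?X)"
      unfolding mean_eq[OF d] by (simp add: sum_divide_distrib)
    also have "\<dots> = measure bernoulli_half ?X"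
      using m sets.sets_into_space by (auto simp: Int_absorb2)
    finally show "emeasure \<mu> ?X = emeasure bernoulli_half ?X"
      by (simp add: \<mu>.emeasure_eq_measure B.emeasure_eq_measure)
  qed (rule \<mu>.finite_measure_axioms)
qed

text \<open>
  The probabilities of the \<open>2^N\<close> cylinders of length \<open>N\<close> add up to \<open>1\<close>; if none exceeded \<open>2^-N\<close>,
  all of them would be equal to it.
\<close>

lemma exists_frequent_cylinder:
  assumes p: "prob_space \<mu>" "sets \<mu> = sets borel" and ne: "\<mu> \<noteq> bernoulli_half"
  shows "\<exists>N u. u < 2 ^ N \<and> measure \<mu> (cylinder N u) > 1 / 2 ^ N"
proof (rule ccontr)
  assume *: "\<not> ?thesis"
  have le: "measure \<mu> (cylinder N u) \<le> 1 / 2 ^ N" if "u < 2 ^ N" for N u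
    using that * by (meson not_less)
  interpret \<mu>: prob_space \<mu> by fact
  have "measure \<mu> (cylinder N u) = 1 / 2 ^ N" if u: "u < 2 ^ N" for N u
  proof (rule ccontr)
    assume "measure \<mu> (cylinder N u) \<noteq> 1 / 2 ^ N"
    then have "(\<Sum>u<(2::nat) ^ N. measure \<mu> (cylinder N u)) < (\<Sum>u<(2::nat) ^ N. 1 / 2 ^ N :: real)"
      using u le by (intro sum_strict_mono_ex1) force+
    moreover have "(\<Sum>u<(2::nat) ^ N. measure \<mu> (cylinder N u)) = 1"
      using integral_depends_on(2)[OF p depends_on_const[of N 1]] by (simp add: \<mu>.prob_space)
    ultimately show False by simp
  qed
  then show False using eq_bernoulli_halfI[OF p] ne by blast
qed

section \<open>Averages over disjoint blocks\<close>

text \<open>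
  The average of \<open>f\<close> over the first \<open>n\<close> consecutive blocks of length \<open>N\<close>.
\<close>

definition block_avg :: "nat \<Rightarrow> nat \<Rightarrow> ((nat \<Rightarrow> bool) \<Rightarrow> real) \<Rightarrow> (nat \<Rightarrow> bool) \<Rightarrow> real" where
  "block_avg N n f x = (\<Sum>i<n. f ((shift ^^ (N * i)) x)) / n"

lemma depends_on_block_sum:
  fixes f :: "(nat \<Rightarrow> bool) \<Rightarrow> real"
  assumes "depends_on N f" shows "depends_on (n * N) (\<lambda>x. \<Sum>i<n. f ((shift ^^ (N * i)) x))"
proof (rule depends_on_sum)
  fix i assume "i \<in> {..<n}"
  then have "N + N * i \<le> n * N" using mult_le_mono1[of "Suc i" n N] by (simp add: mult.commute)
  then show "depends_on (n * N) (\<lambda>x. f ((shift ^^ (N * i)) x))"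
    by (rule depends_on_mono[OF depends_on_shift[OF assms]])
qed

lemma depends_on_block_avg:
  "depends_on N f \<Longrightarrow> depends_on (n * N) (block_avg N n f)"
  unfolding block_avg_def[abs_def]
  by (rule depends_on_map[where h="\<lambda>t. t / n", OF depends_on_block_sum])

lemma integral_block_avg:
  assumes \<mu>: "\<mu> \<in> invariant_measures" and f: "depends_on N f" and n: "n > 0"
  shows "integral\<^sup>L \<mu> (block_avg N n f) = integral\<^sup>L \<mu> f"
proof -
  have p: "prob_space \<mu>" "sets \<mu> = sets borel" using \<mu> by (auto simp: invariant_measures_def)
  have "integral\<^sup>L \<mu> (block_avg N n f) = (\<Sum>i<n. \<integral>x. f ((shift ^^ (N * i)) x) \<partial>\<mu>) / n"
    unfolding block_avg_def[abs_def]
    by (simp add: integral_depends_on(1)[OF p depends_on_shift[OF f]])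
  also have "\<dots> = integral\<^sup>L \<mu> f"
    using n by (simp add: integral_shift[OF \<mu> depends_on_measurable[OF f refl]])
  finally show ?thesis .
qed

text \<open>
  The variance of a sum of independent terms is additive.  The induction splits off the first block;
  the mixed term vanishes by independence.
\<close>

lemma mean_block_sum_square:
  assumes f: "depends_on N f" and z: "mean f = 0"
  shows "mean (\<lambda>x. (\<Sum>i<n. f ((shift ^^ (N * i)) x))\<^sup>2) = n * mean (\<lambda>x. (f x)\<^sup>2)"
proof (induction n)
  case (Suc n)
  let ?S = "\<lambda>n x. \<Sum>i<n. f ((shift ^^ (N * i)) x)"
  have S: "depends_on (n * N) (?S n)" by (rule depends_on_block_sum[OF f])
  have split: "?S (Suc n) x = f x + ?S n ((shift ^^ N) x)" for x
    by (simp add: sum.lessThan_Suc_shift funpow_add algebra_simps del: sum.lessThan_Suc)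
       (simp flip: funpow_add comp_apply[of "shift ^^ _"] add: add.commute)
  have d1: "depends_on (n * N + N) (\<lambda>x. (f x)\<^sup>2)"
    by (rule depends_on_map[where h="\<lambda>t. t\<^sup>2", OF depends_on_mono[OF f]]) auto
  have d2: "depends_on (n * N + N) (\<lambda>x. f x * ?S n ((shift ^^ N) x))"
    using depends_on_shift[OF S, of N] depends_on_mono[OF f, of "n * N + N"]
    by (intro depends_on_map2[where h="(*)"]) auto
  have d3: "depends_on (n * N + N) (\<lambda>x. (?S n ((shift ^^ N) x))\<^sup>2)"
    by (rule depends_on_map[where h="\<lambda>t. t\<^sup>2", OF depends_on_shift[OF S]])
  have "mean (\<lambda>x. (?S (Suc n) x)\<^sup>2)
      = mean (\<lambda>x. (f x)\<^sup>2 + 2 * (f x * ?S n ((shift ^^ N) x)) + (?S n ((shift ^^ N) x))\<^sup>2)"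
    unfolding split by (simp add: power2_sum algebra_simps)
  also have "\<dots> = mean (\<lambda>x. (f x)\<^sup>2) + 2 * mean (\<lambda>x. f x * ?S n ((shift ^^ N) x))
      + mean (\<lambda>x. (?S n ((shift ^^ N) x))\<^sup>2)"
    using integrable_bernoulli[OF d1] integrable_bernoulli[OF d2] integrable_bernoulli[OF d3] by simp
  also have "mean (\<lambda>x. f x * ?S n ((shift ^^ N) x)) = 0"
    using mean_mult_shift[OF f S] z by simp
  also have "mean (\<lambda>x. (?S n ((shift ^^ N) x))\<^sup>2) = mean (\<lambda>x. (?S n x)\<^sup>2)"
    by (rule integral_shift[OF bernoulli_half_invariant depends_on_measurable[OF depends_on_map[where h="\<lambda>t. t\<^sup>2", OF S] refl]])
  finally show ?case using Suc.IH by (simp add: algebra_simps)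
qed simp

lemma mean_block_avg_deviation:
  assumes f: "depends_on N f" and n: "n > 0" and b: "\<And>x. \<bar>f x - mean f\<bar> \<le> 1"
  shows "mean (\<lambda>x. (block_avg N n f x - mean f)\<^sup>2) \<le> 1 / n"
proof -
  let ?g = "\<lambda>x. f x - mean f"
  have g: "depends_on N ?g" by (rule depends_on_map[where h="\<lambda>t. t - mean f", OF f])
  interpret prob_space bernoulli_half by (rule prob_space_bernoulli_half)
  have z: "mean ?g = 0" using integrable_bernoulli[OF f] by (simp add: prob_space)
  have "mean (\<lambda>x. (block_avg N n f x - mean f)\<^sup>2) = mean (\<lambda>x. (\<Sum>i<n. ?g ((shift ^^ (N * i)) x))\<^sup>2 / n\<^sup>2)"
    using n by (intro Bochner_Integration.integral_cong)
      (auto simp: block_avg_def sum_subtractf power_divide[symmetric] diff_divide_distrib)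
  also have "\<dots> = (n * mean (\<lambda>x. (?g x)\<^sup>2)) / n\<^sup>2"
    unfolding mean_block_sum_square[OF g z, symmetric] by simp
  also have "\<dots> = mean (\<lambda>x. (?g x)\<^sup>2) / n"
    using n by (simp add: power2_eq_square)
  also have "mean (\<lambda>x. (?g x)\<^sup>2) \<le> mean (\<lambda>_. 1)"
    using b integrable_bernoulli[OF depends_on_map[OF f, of "\<lambda>t. (t - mean f)\<^sup>2"]]
    by (intro integral_mono) (auto simp: abs_square_le_1)
  finally show ?thesis using n by (simp add: prob_space divide_right_mono)
qed

section \<open>The stages of the construction\<close>

text \<open>
  \<open>stage j\<close> depends on \<open>window j\<close> coordinates, and \<open>repeats j\<close> blocks of that length are averaged to get
  the next stage.  The variance \<open>1 / repeats j\<close> must be small compared with the product of the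
  thresholds \<open>4^-(j+1)\<close> and \<open>4^-(j+2)\<close>; this fixes \<open>repeats\<close>, and then \<open>window\<close> solves
  \<open>window (j+1) = repeats j * window j\<close> with \<open>window 0 = 1\<close>.  The values of \<open>stage j\<close> are multiples of
  \<open>1 / denom j\<close>.  Finally, \<open>spread j\<close> is the number of shifts over which \<open>increment j\<close> is averaged; it
  equals the number of Walsh functions that can occur in \<open>increment j\<close>.
\<close>

definition repeats :: "nat \<Rightarrow> nat" where "repeats j = 4 ^ (2 * j + 4)"
definition window :: "nat \<Rightarrow> nat" where "window j = 4 ^ (j * (j + 3))"
definition denom :: "nat \<Rightarrow> nat" where "denom j = 2 * window j"
definition spread :: "nat \<Rightarrow> nat" where "spread j = 2 ^ window (Suc j)"

text \<open>
  A number \<open>w \<ge> 1\<close> encodes the 0-1 word formed by its binary digits below the leading one, whose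
  position \<open>floor_log w\<close> is the length of the word.  If \<open>j + 1 = 2^a + r\<close> with \<open>r < 2^a\<close>, the word with
  code \<open>r + 1\<close> is tested at stage \<open>j\<close>, so that every code recurs once for each large \<open>a\<close>.
\<close>

definition word :: "nat \<Rightarrow> nat" where "word j = Suc (Suc j - 2 ^ floor_log (Suc j))"
definition word_len :: "nat \<Rightarrow> nat" where "word_len j = floor_log (word j)"

lemma window_Suc: "window (Suc j) = repeats j * window j"
  by (simp add: window_def repeats_def algebra_simps flip: power_add)

lemma repeats_pos: "0 < repeats j" and denom_pos: "0 < denom j"
  by (simp_all add: repeats_def window_def denom_def)

lemma denom_Suc: "denom (Suc j) = repeats j * denom j"
  by (simp add: denom_def window_Suc)

lemma word_len_le: "word_len j \<le> j"
proof -
  have "0 < (2 :: nat) ^ floor_log (Suc j)" by simp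
  then have "word j \<le> Suc j" unfolding word_def by linarith
  then have "word_len j \<le> floor_log (Suc j)" unfolding word_len_def by (rule floor_log_le_iff)
  also have "\<dots> \<le> j"
    using floor_log_exp2_le[of "Suc j"] less_exp[of "floor_log (Suc j)"] by linarith
  finally show ?thesis .
qed

lemma le_window: "j \<le> window j"
proof -
  have "j < 4 ^ j" by (induction j) auto
  also have "(4 :: nat) ^ j \<le> 4 ^ (j * (j + 3))" by (intro power_increasing) auto
  finally show ?thesis by (simp add: window_def)
qed

lemma word_recurrent:
  assumes "v < 2 ^ N"
  shows "\<exists>j\<ge>J. word_len j = N \<and> cylinder (word_len j) (word j) = cylinder N v"
proof -
  define w where "w = 2 ^ N + v"
  \<comment> \<open>any exponent \<open>a\<close> with \<open>w \<le> 2^a\<close> gives an index at which the code \<open>w\<close> occurs\<close>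
  define a where "a = w + J"
  define j where "j = 2 ^ a + (w - 1) - 1"
  have "0 < (2 :: nat) ^ N" by simp
  then have w: "1 \<le> w" unfolding w_def by linarith
  have a: "w \<le> a" "J \<le> a" "a < 2 ^ a" by (simp_all add: a_def less_exp)
  have j: "Suc j = 2 ^ a + (w - 1)" using a by (simp add: j_def)
  have "floor_log (2 ^ a + (w - 1)) = a" using w a 
    by (intro floor_log_eqI) linarith+
  then have word: "word j = w" using w by (simp add: word_def j)
  have len: "floor_log w = N" using assms unfolding w_def by (intro floor_log_eqI) auto
  have "bit w i = bit v i" if "i < N" for i
  proof -
    have "bit (take_bit N w) i = bit (take_bit N v) i" by (simp add: w_def take_bit_eq_mod)
    then show ?thesis using that by (simp add: bit_take_bit_iff)
  qed
  then have "cylinder N w = cylinder N v" by (auto simp: cylinder_def)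
  moreover have "J \<le> j" using j a w by linarith
  ultimately show ?thesis using word len by (intro exI[of _ j]) (simp add: word_len_def)
qed

definition word_test :: "nat \<Rightarrow> (nat \<Rightarrow> bool) \<Rightarrow> real" where
  "word_test j = indicator (cylinder (word_len j) (word j))"

text \<open>
  The inner positive part keeps a word that is too rare from lowering the integral: otherwise a later
  test could undo the gain of an earlier one, being far stronger than the subtraction of \<open>4^-(j+1)\<close>.
\<close>

primrec stage :: "nat \<Rightarrow> (nat \<Rightarrow> bool) \<Rightarrow> real" where
  "stage 0 = (\<lambda>x. 0)"
| "stage (Suc j) = (\<lambda>x. max 0 (block_avg (window j) (repeats j) (stage j) x
     + max 0 (block_avg (window j) (repeats j) (word_test j) x - 1 / 2 ^ word_len j) / 2 ^ Suc j
     - 1 / 4 ^ Suc j))"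

lemma depends_on_word_test: "depends_on (window j) (word_test j)"
proof -
  have "depends_on (word_len j) (word_test j)"
    unfolding depends_on_def word_test_def cylinder_def indicator_def by auto
  then show ?thesis
    using word_len_le le_window by (rule depends_on_mono[OF _ order_trans])
qed

lemma depends_on_stage: "depends_on (window j) (stage j)"
proof (induction j)
  case (Suc j)
  have "depends_on (window (Suc j)) (block_avg (window j) (repeats j) (stage j))"
       "depends_on (window (Suc j)) (block_avg (window j) (repeats j) (word_test j))"
    unfolding window_Suc using Suc depends_on_word_test by (auto intro: depends_on_block_avg)
  from depends_on_map2[where h="\<lambda>a b. max 0 (a + max 0 (b - 1 / 2 ^ word_len j) / 2 ^ Suc j - 1 / 4 ^ Suc j)", OF this]
  show ?case by simp
qed (simp add: depends_on_const)

lemma block_avg_bounds: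
  assumes "n > 0" "\<And>x. a \<le> f x" "\<And>x. f x \<le> b"
  shows "a \<le> block_avg N n f x" "block_avg N n f x \<le> b"
proof -
  have "n * a \<le> (\<Sum>i<n. f ((shift ^^ (N * i)) x))" "(\<Sum>i<n. f ((shift ^^ (N * i)) x)) \<le> n * b"
    using sum_bounded_below[of "{..<n}" a "\<lambda>i. f ((shift ^^ (N * i)) x)"]
      sum_bounded_above[of "{..<n}" "\<lambda>i. f ((shift ^^ (N * i)) x)" b] assms(2,3) by auto
  then show "a \<le> block_avg N n f x" "block_avg N n f x \<le> b"
    using assms(1) by (auto simp: block_avg_def field_simps)
qed

lemma word_test_bounds: "0 \<le> word_test j x" "word_test j x \<le> 1"
  by (auto simp: word_test_def indicator_def)

lemma word_test_excess_le:
  "max 0 (block_avg (window j) (repeats j) (word_test j) x - 1 / 2 ^ word_len j) / 2 ^ Suc j \<le> 1 / 2 ^ Suc j"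
proof -
  have "block_avg (window j) (repeats j) (word_test j) x \<le> 1"
    by (rule block_avg_bounds(2)[OF repeats_pos word_test_bounds])
  moreover have "0 \<le> (1 :: real) / 2 ^ word_len j" by simp
  ultimately show ?thesis by (intro divide_right_mono max.boundedI) (linarith | simp)+
qed

lemma stage_bounds: "0 \<le> stage j x \<and> stage j x \<le> 1 - 1 / 2 ^ j"
proof (induction j arbitrary: x)
  case (Suc j)
  note s = block_avg_bounds[OF repeats_pos[of j], of 0 "stage j" "1 - 1 / 2 ^ j" "window j" x]
  note word_test_excess_le[of j x]
  moreover have "block_avg (window j) (repeats j) (stage j) x \<le> 1 - 1 / 2 ^ j" using s Suc by auto
  moreover have "(1 :: real) / 2 ^ j = 1 / 2 ^ Suc j + 1 / 2 ^ Suc j" by simp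
  moreover have "(0 :: real) < 1 / 4 ^ Suc j" by simp
  moreover have "(1 :: real) / 2 ^ Suc j \<le> 1 / 1" by (intro frac_le one_le_power) auto
  ultimately show ?case unfolding stage.simps by linarith
qed simp

lemma stage_le_1: "stage j x \<le> 1"
proof -
  have "0 \<le> (1 :: real) / 2 ^ j" by simp
  then show ?thesis using stage_bounds[of j x] by linarith
qed

definition increment :: "nat \<Rightarrow> (nat \<Rightarrow> bool) \<Rightarrow> real" where
  "increment j x = stage (Suc j) x - block_avg (window j) (repeats j) (stage j) x"

lemma depends_on_increment: "depends_on (window (Suc j)) (increment j)"
  unfolding increment_def[abs_def]
  using depends_on_stage[of "Suc j"] depends_on_block_avg[OF depends_on_stage[of j], of "repeats j"]
  by (intro depends_on_map2[where h="(-)"]) (auto simp: window_Suc)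

text \<open>
  If the outer positive part has no effect, the step adds at most \<open>2^-(j+1)\<close> and subtracts
  \<open>4^-(j+1)\<close>.  If it cuts off a negative value, the averaged stage was at most \<open>4^-(j+1)\<close>.
\<close>

lemma abs_increment_le: "\<bar>increment j x\<bar> \<le> 1 / 2 ^ Suc j"
proof -
  let ?a = "block_avg (window j) (repeats j) (stage j) x"
  let ?t = "max 0 (block_avg (window j) (repeats j) (word_test j) x - 1 / 2 ^ word_len j) / 2 ^ Suc j"
  have "?t \<le> 1 / 2 ^ Suc j" by (rule word_test_excess_le)
  moreover have "0 \<le> ?t" by simp
  moreover have "0 \<le> ?a"
    by (intro block_avg_bounds(1)[OF repeats_pos _ stage_le_1]) (simp add: stage_bounds)
  moreover have "(1 :: real) / 4 ^ Suc j \<le> 1 / 2 ^ Suc j"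
    by (intro divide_left_mono power_mono) auto
  moreover have "(0 :: real) < 1 / 4 ^ Suc j" by simp
  ultimately show ?thesis unfolding increment_def unfolding stage.simps by linarith
qed

text \<open>
  Both lower bounds come from dropping positive parts, after which only averages remain, and
  averaging does not change the integral.
\<close>

lemma
  assumes \<mu>: "\<mu> \<in> invariant_measures"
  shows integral_stage_ge: "integral\<^sup>L \<mu> (stage (Suc j)) \<ge> integral\<^sup>L \<mu> (stage j) - 1 / 4 ^ Suc j"
    and integral_stage_ge_word_test: "integral\<^sup>L \<mu> (stage (Suc j)) \<ge> integral\<^sup>L \<mu> (stage j)
       + (measure \<mu> (cylinder (word_len j) (word j)) - 1 / 2 ^ word_len j) / 2 ^ Suc j - 1 / 4 ^ Suc j"
    and integral_increment: "integral\<^sup>L \<mu> (increment j) = integral\<^sup>L \<mu> (stage (Suc j)) - integral\<^sup>L \<mu> (stage j)"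
proof -
  have p: "prob_space \<mu>" "sets \<mu> = sets borel" using \<mu> by (auto simp: invariant_measures_def)
  interpret prob_space \<mu> by (rule p(1))
  let ?a = "block_avg (window j) (repeats j) (stage j)" and ?t = "block_avg (window j) (repeats j) (word_test j)"
  note int = integral_depends_on(1)[OF p depends_on_stage[of "Suc j"]]
    integral_depends_on(1)[OF p depends_on_block_avg[OF depends_on_stage[of j], of "repeats j"]]
    integral_depends_on(1)[OF p depends_on_block_avg[OF depends_on_word_test[of j], of "repeats j"]]
  have a: "integral\<^sup>L \<mu> ?a = integral\<^sup>L \<mu> (stage j)"
    by (rule integral_block_avg[OF \<mu> depends_on_stage repeats_pos])
  have c: "cylinder (word_len j) (word j) \<in> sets \<mu>" using cylinder_sets p(2) by simp
  have "integral\<^sup>L \<mu> ?t = integral\<^sup>L \<mu> (word_test j)"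
    by (rule integral_block_avg[OF \<mu> depends_on_word_test repeats_pos])
  also have "\<dots> = measure \<mu> (cylinder (word_len j) (word j))"
    unfolding word_test_def using c sets.sets_into_space by (auto simp: Int_absorb2)
  finally have t: "integral\<^sup>L \<mu> ?t = measure \<mu> (cylinder (word_len j) (word j))" .
  have "(\<integral>x. ?a x - 1 / 4 ^ Suc j \<partial>\<mu>) \<le> integral\<^sup>L \<mu> (stage (Suc j))"
  proof (rule integral_mono)
    fix x
    have "0 \<le> max 0 (?t x - 1 / 2 ^ word_len j) / 2 ^ Suc j" by simp
    then show "?a x - 1 / 4 ^ Suc j \<le> stage (Suc j) x" unfolding stage.simps by linarith
  qed (use int in \<open>auto simp del: stage.simps\<close>)
  then show "integral\<^sup>L \<mu> (stage (Suc j)) \<ge> integral\<^sup>L \<mu> (stage j) - 1 / 4 ^ Suc j"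
    using int a by (simp add: prob_space)
  have "(\<integral>x. ?a x + (?t x - 1 / 2 ^ word_len j) / 2 ^ Suc j - 1 / 4 ^ Suc j \<partial>\<mu>) \<le> integral\<^sup>L \<mu> (stage (Suc j))"
  proof (rule integral_mono)
    fix x
    have "(?t x - 1 / 2 ^ word_len j) / 2 ^ Suc j \<le> max 0 (?t x - 1 / 2 ^ word_len j) / 2 ^ Suc j"
      by (intro divide_right_mono) auto
    then show "?a x + (?t x - 1 / 2 ^ word_len j) / 2 ^ Suc j - 1 / 4 ^ Suc j \<le> stage (Suc j) x"
      unfolding stage.simps by linarith
  qed (use int in \<open>auto simp del: stage.simps\<close>)
  then show "integral\<^sup>L \<mu> (stage (Suc j)) \<ge> integral\<^sup>L \<mu> (stage j)
       + (measure \<mu> (cylinder (word_len j) (word j)) - 1 / 2 ^ word_len j) / 2 ^ Suc j - 1 / 4 ^ Suc j"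
    using int a t by (simp add: prob_space)
  show "integral\<^sup>L \<mu> (increment j) = integral\<^sup>L \<mu> (stage (Suc j)) - integral\<^sup>L \<mu> (stage j)"
    unfolding increment_def[abs_def] using int a by (simp del: stage.simps)
qed

text \<open>
  Let \<open>Y\<close> and \<open>Z\<close> be the deviations of the two block averages from their means, and \<open>\<epsilon> = 4^-(j+1)\<close>.  By
  the induction hypothesis the mean of \<open>stage j\<close> uses up only half of the subtracted \<open>\<epsilon>\<close>, so the
  next stage is at most the positive part of \<open>Y + \<bar>Z\<bar> - \<epsilon>/2\<close>.  Bounding a positive part by a square
  makes the variance estimate applicable.
\<close>

lemma mean_stage_le: "mean (stage j) \<le> 1 / (2 * 4 ^ Suc j)"
proof (induction j)
  case (Suc j)
  interpret prob_space bernoulli_half by (rule prob_space_bernoulli_half)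
  define \<epsilon> :: real where "\<epsilon> = 1 / 4 ^ Suc j"
  define Y where "Y x = block_avg (window j) (repeats j) (stage j) x - mean (stage j)" for x
  define Z where "Z x = block_avg (window j) (repeats j) (word_test j) x - mean (word_test j)" for x
  have \<epsilon>: "\<epsilon> > 0" by (simp add: \<epsilon>_def)
  have word_test: "mean (word_test j) = 1 / 2 ^ word_len j"
    unfolding word_test_def by (rule mean_indicator_cylinder)
  have m: "mean (stage j) \<le> \<epsilon> / 2" using Suc by (simp add: \<epsilon>_def)
  have Y: "integrable bernoulli_half (\<lambda>x. (Y x)\<^sup>2)" "mean (\<lambda>x. (Y x)\<^sup>2) \<le> 1 / repeats j"
    and Z: "integrable bernoulli_half (\<lambda>x. (Z x)\<^sup>2)" "mean (\<lambda>x. (Z x)\<^sup>2) \<le> 1 / repeats j"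
  proof -
    have dev: "integrable bernoulli_half (\<lambda>x. (block_avg (window j) (repeats j) f x - mean f)\<^sup>2)"
      "mean (\<lambda>x. (block_avg (window j) (repeats j) f x - mean f)\<^sup>2) \<le> 1 / repeats j"
      if f: "depends_on (window j) f" "\<And>x. 0 \<le> f x" "\<And>x. f x \<le> 1" for f
    proof -
      show "integrable bernoulli_half (\<lambda>x. (block_avg (window j) (repeats j) f x - mean f)\<^sup>2)"
        by (rule integrable_bernoulli[OF depends_on_map[where h="\<lambda>t. (t - mean f)\<^sup>2", OF depends_on_block_avg[OF f(1)]]])
      have "0 \<le> mean f" using f(2) by (intro Bochner_Integration.integral_nonneg) auto
      moreover have "mean f \<le> mean (\<lambda>_. 1)"
        using f integrable_bernoulli[OF f(1)] by (intro integral_mono) auto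
      ultimately have "\<bar>f x - mean f\<bar> \<le> 1" for x
        using f(2,3)[of x] by (simp add: prob_space abs_le_iff)
      then show "mean (\<lambda>x. (block_avg (window j) (repeats j) f x - mean f)\<^sup>2) \<le> 1 / repeats j"
        by (rule mean_block_avg_deviation[OF f(1) repeats_pos])
    qed
    show "integrable bernoulli_half (\<lambda>x. (Y x)\<^sup>2)" "mean (\<lambda>x. (Y x)\<^sup>2) \<le> 1 / repeats j"
      "integrable bernoulli_half (\<lambda>x. (Z x)\<^sup>2)" "mean (\<lambda>x. (Z x)\<^sup>2) \<le> 1 / repeats j"
      unfolding Y_def Z_def using stage_bounds word_test_bounds stage_le_1
      by (auto intro!: dev depends_on_stage depends_on_word_test)
  qed
  have le: "stage (Suc j) x \<le> ((Y x)\<^sup>2 + (Z x)\<^sup>2) / \<epsilon>" for x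
  proof -
    have "stage (Suc j) x \<le> max 0 (Y x + \<bar>Z x\<bar> - \<epsilon> / 2)"
    proof -
      have "max 0 (Z x) / 2 ^ Suc j \<le> \<bar>Z x\<bar> / 1"
        by (intro frac_le one_le_power) auto
      then show ?thesis
        using m unfolding stage.simps Y_def Z_def word_test \<epsilon>_def[symmetric] by auto
    qed
    \<comment> \<open>\<open>max 0 (y - a) \<le> y^2 / (4 * a)\<close> for \<open>a > 0\<close>, with \<open>a = \<epsilon>/2\<close>\<close>
    also have "\<dots> \<le> (Y x + \<bar>Z x\<bar>)\<^sup>2 / (2 * \<epsilon>)"
    proof -
      have "0 \<le> (Y x + \<bar>Z x\<bar> - \<epsilon>)\<^sup>2" by simp
      then have "(Y x + \<bar>Z x\<bar> - \<epsilon> / 2) * (2 * \<epsilon>) \<le> (Y x + \<bar>Z x\<bar>)\<^sup>2"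
        by (simp add: power2_eq_square algebra_simps)
      then show ?thesis using \<epsilon> by (simp add: pos_le_divide_eq)
    qed
    also have "\<dots> \<le> 2 * ((Y x)\<^sup>2 + (Z x)\<^sup>2) / (2 * \<epsilon>)"
    proof (rule divide_right_mono)
      show "(Y x + \<bar>Z x\<bar>)\<^sup>2 \<le> 2 * ((Y x)\<^sup>2 + (Z x)\<^sup>2)"
        using zero_le_power2[of "Y x - \<bar>Z x\<bar>"] by (simp add: power2_eq_square algebra_simps)
    qed (use \<epsilon> in simp)
    also have "\<dots> = ((Y x)\<^sup>2 + (Z x)\<^sup>2) / \<epsilon>" by (rule mult_divide_mult_cancel_left) simp
    finally show ?thesis .
  qed
  have "mean (stage (Suc j)) \<le> mean (\<lambda>x. ((Y x)\<^sup>2 + (Z x)\<^sup>2) / \<epsilon>)"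
    using Y Z integrable_bernoulli[OF depends_on_stage[of "Suc j"]] le by (intro integral_mono) auto
  also have "\<dots> = (mean (\<lambda>x. (Y x)\<^sup>2) + mean (\<lambda>x. (Z x)\<^sup>2)) / \<epsilon>" using Y Z by simp
  also have "\<dots> \<le> (1 / repeats j + 1 / repeats j) / \<epsilon>"
    using Y Z \<epsilon> by (intro divide_right_mono add_mono) auto
  also have "\<dots> = 1 / (2 * 4 ^ Suc (Suc j))"
    by (simp add: \<epsilon>_def repeats_def power_add power_mult field_simps)
       (simp add: power2_eq_square flip: power_mult_distrib)
  finally show ?case .
qed simp

lemma integral_stage_nonneg: "0 \<le> integral\<^sup>L \<mu> (stage j)"
  using stage_bounds by (intro Bochner_Integration.integral_nonneg) auto

lemma mean_stage_tendsto_0: "(\<lambda>j. mean (stage j)) \<longlonglongrightarrow> 0"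
proof (rule tendsto_sandwich[of "\<lambda>_. 0" _ _ "\<lambda>j. 1 / (2 * 4 ^ Suc j)"])
  show "(\<lambda>j. 1 / (2 * 4 ^ Suc j) :: real) \<longlonglongrightarrow> 0" by real_asymp
qed (use mean_stage_le integral_stage_nonneg in \<open>auto simp del: stage.simps power_Suc\<close>)

text \<open>
  A word with excess probability \<open>\<eta>\<close> is tested at some \<open>j\<close> with \<open>\<eta> / 2^(j+1) > 2 / 4^(j+1)\<close>.  This gain
  exceeds the subtraction at that stage and all later ones together.
\<close>

lemma integral_stage_eventually_positive:
  assumes \<mu>: "\<mu> \<in> invariant_measures" and ne: "\<mu> \<noteq> bernoulli_half"
  shows "\<exists>\<gamma>>0. \<exists>j0. \<forall>j\<ge>j0. \<gamma> \<le> integral\<^sup>L \<mu> (stage j)"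
proof -
  have p: "prob_space \<mu>" "sets \<mu> = sets borel" using \<mu> by (auto simp: invariant_measures_def)
  obtain N v where v: "v < 2 ^ N" "measure \<mu> (cylinder N v) > 1 / 2 ^ N"
    using exists_frequent_cylinder[OF p ne] by blast
  define \<eta> where "\<eta> = measure \<mu> (cylinder N v) - 1 / 2 ^ N"
  have \<eta>: "\<eta> > 0" using v by (simp add: \<eta>_def)
  obtain J where J: "2 / \<eta> < 2 ^ J" using real_arch_pow[of 2] by auto
  obtain j where j: "J \<le> j" "word_len j = N" "cylinder (word_len j) (word j) = cylinder N v"
    using word_recurrent[OF v(1)] by blast
  \<comment> \<open>\<open>1 / (3 * 4 ^ i)\<close> is the total \<open>4^-(i+1) + 4^-(i+2) + ...\<close> of all subtractions from stage \<open>i\<close> on\<close>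
  define a where "a i = integral\<^sup>L \<mu> (stage i) - 1 / (3 * 4 ^ i)" for i
  have "mono a"
    unfolding mono_iff_le_Suc
  proof
    fix i
    have "1 / (3 * 4 ^ i) = 1 / 4 ^ Suc i + (1 / (3 * 4 ^ Suc i) :: real)" by (simp add: field_simps)
    then show "a i \<le> a (Suc i)" using integral_stage_ge[OF \<mu>, of i] by (simp add: a_def)
  qed
  have "2 / \<eta> < 2 ^ Suc j"
  proof -
    have "(2 :: real) ^ J \<le> 2 ^ Suc j" using j by (intro power_increasing) auto
    then show ?thesis using J by linarith
  qed
  then have "2 / 4 ^ Suc j < \<eta> / 2 ^ Suc j"
  proof -
    have "(4 :: real) ^ Suc j = 2 ^ Suc j * 2 ^ Suc j" by (simp flip: power_mult_distrib)
    moreover assume "2 / \<eta> < 2 ^ Suc j"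
    ultimately show ?thesis using \<eta> by (simp add: field_simps)
  qed
  moreover have "integral\<^sup>L \<mu> (stage (Suc j)) \<ge> \<eta> / 2 ^ Suc j - 1 / 4 ^ Suc j"
    using integral_stage_ge_word_test[OF \<mu>, of j] integral_stage_nonneg[of \<mu> j] j by (simp add: \<eta>_def)
  moreover have "(1 :: real) / (3 * 4 ^ Suc j) \<le> 1 / 4 ^ Suc j" by (intro divide_left_mono) auto
  ultimately have "a (Suc j) > 0" by (simp add: a_def del: power_Suc)
  moreover have "a (Suc j) \<le> integral\<^sup>L \<mu> (stage i)" if "Suc j \<le> i" for i
  proof -
    have "a (Suc j) \<le> a i" using \<open>mono a\<close> that by (rule monoD)
    moreover have "0 \<le> (1 :: real) / (3 * 4 ^ i)" by simp
    ultimately show ?thesis unfolding a_def by linarith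
  qed
  ultimately show ?thesis by blast
qed

section \<open>The potential\<close>

lemma increment_measurable: "increment j \<in> borel_measurable borel"
  by (rule depends_on_measurable[OF depends_on_increment refl])

text \<open>
  The shifts start at order \<open>j\<close> and not at \<open>0\<close>: this confines the nonzero frequencies to multiples of
  \<open>2^j\<close>, which makes every single coefficient of the potential a finite sum.
\<close>

definition spread_increment :: "nat \<Rightarrow> (nat \<Rightarrow> bool) \<Rightarrow> real" where
  "spread_increment j x = (\<Sum>i<spread j. increment j ((shift ^^ (j + i)) x)) / spread j"

lemma spread_pos: "0 < spread j"
  by (simp add: spread_def)

lemma depends_on_spread_increment: "\<exists>R. depends_on R (spread_increment j)"
proof
  have "depends_on (window (Suc j) + (j + spread j)) (\<lambda>x. \<Sum>i<spread j. increment j ((shift ^^ (j + i)) x))"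
  proof (rule depends_on_sum)
    fix i assume "i \<in> {..<spread j}"
    then show "depends_on (window (Suc j) + (j + spread j)) (\<lambda>x. increment j ((shift ^^ (j + i)) x))"
      by (intro depends_on_mono[OF depends_on_shift[OF depends_on_increment]]) auto
  qed
  then show "depends_on (window (Suc j) + (j + spread j)) (spread_increment j)"
    unfolding spread_increment_def[abs_def] by (rule depends_on_map[where h="\<lambda>t. t / spread j"])
qed

lemma spread_increment_measurable: "spread_increment j \<in> borel_measurable borel"
  using depends_on_spread_increment depends_on_measurable by blast

lemma abs_spread_increment_le: "\<bar>spread_increment j x\<bar> \<le> 1 / 2 ^ Suc j"
proof -
  have "\<bar>\<Sum>i<spread j. increment j ((shift ^^ (j + i)) x)\<bar> \<le> (\<Sum>i<spread j. 1 / 2 ^ Suc j)"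
    by (rule order_trans[OF sum_abs]) (intro sum_mono abs_increment_le)
  then have "\<bar>\<Sum>i<spread j. increment j ((shift ^^ (j + i)) x)\<bar> \<le> spread j * (1 / 2 ^ Suc j)"
    by (simp only: sum_constant card_lessThan)
  then show ?thesis
    using spread_pos[of j] by (simp add: spread_increment_def abs_divide pos_divide_le_eq mult.commute)
qed

lemma integral_spread_increment:
  assumes \<mu>: "\<mu> \<in> invariant_measures"
  shows "integral\<^sup>L \<mu> (spread_increment j) = integral\<^sup>L \<mu> (increment j)"
proof -
  have p: "prob_space \<mu>" "sets \<mu> = sets borel" using \<mu> by (auto simp: invariant_measures_def)
  have "integral\<^sup>L \<mu> (spread_increment j) = (\<Sum>i<spread j. \<integral>x. increment j ((shift ^^ (j + i)) x) \<partial>\<mu>) / spread j"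
    unfolding spread_increment_def[abs_def]
    by (simp add: integral_depends_on(1)[OF p depends_on_shift[OF depends_on_increment]])
  also have "\<dots> = integral\<^sup>L \<mu> (increment j)"
    using spread_pos[of j] by (simp add: integral_shift[OF \<mu> increment_measurable])
  finally show ?thesis .
qed

definition partial_potential :: "nat \<Rightarrow> (nat \<Rightarrow> bool) \<Rightarrow> real" where
  "partial_potential J x = (\<Sum>j<J. spread_increment j x)"

definition potential :: "(nat \<Rightarrow> bool) \<Rightarrow> real" where
  "potential x = (\<Sum>j. spread_increment j x)"

lemma geometric_tail: "(\<lambda>j. 1 / 2 ^ Suc (j + J) :: real) sums (1 / 2 ^ J)"
proof -
  have "(\<lambda>j. (1 / 2 ^ J) * (1 / 2) ^ Suc j :: real) sums ((1 / 2 ^ J) * 1)"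
    using power_half_series by (rule sums_mult)
  then show ?thesis by (simp add: power_add power_divide mult_ac)
qed

lemma potential_tail: "\<bar>potential x - partial_potential J x\<bar> \<le> 1 / 2 ^ J"
proof -
  have s: "summable (\<lambda>j. spread_increment j x)"
    by (rule summable_comparison_test'[OF sums_summable[OF geometric_tail[of 0]], of 0])
       (use abs_spread_increment_le in simp)
  have "potential x - partial_potential J x = (\<Sum>j. spread_increment (j + J) x)"
    unfolding potential_def partial_potential_def using suminf_minus_initial_segment[OF s] by simp
  moreover have "\<bar>\<Sum>j. spread_increment (j + J) x\<bar> \<le> (\<Sum>j. 1 / 2 ^ Suc (j + J))"
  proof -
    have sg: "summable (\<lambda>j. 1 / 2 ^ Suc (j + J) :: real)" using geometric_tail by (rule sums_summable)
    have sa: "summable (\<lambda>j. \<bar>spread_increment (j + J) x\<bar>)"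
      by (rule summable_comparison_test'[OF sg, of 0]) (use abs_spread_increment_le in simp)
    show ?thesis
      by (rule order_trans[OF summable_rabs[OF sa]]) (intro suminf_le sa sg abs_spread_increment_le)
  qed
  ultimately show ?thesis using sums_unique[OF geometric_tail[of J]] by simp
qed

lemma depends_on_partial_potential: "\<exists>R. depends_on R (partial_potential J)"
proof (induction J)
  case (Suc J)
  obtain R S where R: "depends_on R (partial_potential J)" and S: "depends_on S (spread_increment J)"
    using Suc depends_on_spread_increment by blast
  have "depends_on (R + S) (\<lambda>x. partial_potential J x + spread_increment J x)"
    by (rule depends_on_map2[where h="(+)", OF depends_on_mono[OF R] depends_on_mono[OF S]]) auto
  then show ?case by (auto simp: partial_potential_def[abs_def])
qed (auto simp: partial_potential_def[abs_def] depends_on_const)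

lemma uniform_limit_partial_potential: "uniform_limit UNIV partial_potential potential sequentially"
proof (rule uniform_limitI)
  fix e :: real assume "e > 0"
  moreover have "(\<lambda>J. 1 / 2 ^ J :: real) \<longlonglongrightarrow> 0" by real_asymp
  ultimately have "\<forall>\<^sub>F J in sequentially. (1 / 2 ^ J :: real) < e" by (rule order_tendstoD(2)[rotated])
  then show "\<forall>\<^sub>F J in sequentially. \<forall>x\<in>UNIV. dist (partial_potential J x) (potential x) < e"
    by eventually_elim (auto simp: dist_real_def abs_minus_commute intro: le_less_trans[OF potential_tail])
qed

lemma continuous_potential: "continuous_on UNIV potential"
  by (rule uniform_limit_theorem[OF _ uniform_limit_partial_potential])
     (use depends_on_partial_potential depends_on_continuous in \<open>auto intro!: always_eventually\<close>)

lemma potential_measurable: "potential \<in> borel_measurable borel"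
  by (rule borel_measurable_continuous_onI[OF continuous_potential])

lemma abs_potential_le: "\<bar>potential x\<bar> \<le> 1"
  using potential_tail[of x 0] by (simp add: partial_potential_def)

lemma partial_potential_measurable: "partial_potential J \<in> borel_measurable borel"
  using depends_on_partial_potential depends_on_measurable by blast

lemma abs_partial_potential_le: "\<bar>partial_potential J x\<bar> \<le> 2"
proof -
  have "(1 :: real) / 2 ^ J \<le> 1 / 1" by (intro frac_le one_le_power) auto
  then show ?thesis using potential_tail[of x J] abs_potential_le[of x] by linarith
qed

text \<open>
  The integrals of the increments telescope, because \<open>stage 0 = 0\<close>.
\<close>

lemma integral_stage_tendsto:
  assumes \<mu>: "\<mu> \<in> invariant_measures"
  shows "(\<lambda>J. integral\<^sup>L \<mu> (stage J)) \<longlonglongrightarrow> integral\<^sup>L \<mu> potential"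
proof -
  have p: "prob_space \<mu>" "sets \<mu> = sets borel" using \<mu> by (auto simp: invariant_measures_def)
  have int: "integrable \<mu> (spread_increment j)" "integrable \<mu> potential" "integrable \<mu> (partial_potential J)" for j J
    using integrable_bounded[OF p] spread_increment_measurable abs_spread_increment_le
      potential_measurable abs_potential_le partial_potential_measurable abs_partial_potential_le by blast+
  have eq: "integral\<^sup>L \<mu> (partial_potential J) = integral\<^sup>L \<mu> (stage J)" for J
  proof -
    have "integral\<^sup>L \<mu> (partial_potential J) = (\<Sum>j<J. integral\<^sup>L \<mu> (stage (Suc j)) - integral\<^sup>L \<mu> (stage j))"
      unfolding partial_potential_def[abs_def]
      by (subst Bochner_Integration.integral_sum)
         (use int in \<open>auto simp: integral_spread_increment[OF \<mu>] integral_increment[OF \<mu>] simp del: stage.simps\<close>)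
    also have "\<dots> = integral\<^sup>L \<mu> (stage J)"
      unfolding sum_lessThan_telescope[of "\<lambda>j. integral\<^sup>L \<mu> (stage j)"] by simp
    finally show ?thesis .
  qed
  have bound: "\<bar>integral\<^sup>L \<mu> (stage J) - integral\<^sup>L \<mu> potential\<bar> \<le> 1 / 2 ^ J" for J
  proof -
    have "\<bar>\<integral>x. potential x - partial_potential J x \<partial>\<mu>\<bar> \<le> 1 / 2 ^ J"
      by (rule abs_integral_le[OF p _ potential_tail])
         (intro borel_measurable_diff potential_measurable partial_potential_measurable)
    then show ?thesis using int eq[of J] by simp
  qed
  have lim: "(\<lambda>J. 1 / 2 ^ J :: real) \<longlonglongrightarrow> 0" by real_asymp
  have "(\<lambda>J. integral\<^sup>L \<mu> (stage J) - integral\<^sup>L \<mu> potential) \<longlonglongrightarrow> 0"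
    by (rule Lim_null_comparison[OF _ lim]) (simp add: bound)
  then show ?thesis by (rule LIM_zero_cancel)
qed

lemma mean_potential: "mean potential = 0"
  using integral_stage_tendsto[OF bernoulli_half_invariant] mean_stage_tendsto_0 LIMSEQ_unique by blast

lemma integral_potential_pos:
  assumes "\<mu> \<in> invariant_measures" "\<mu> \<noteq> bernoulli_half"
  shows "0 < integral\<^sup>L \<mu> potential"
proof -
  obtain \<gamma> j0 where \<gamma>: "\<gamma> > 0" "\<forall>j\<ge>j0. \<gamma> \<le> integral\<^sup>L \<mu> (stage j)"
    using integral_stage_eventually_positive[OF assms] by blast
  have "\<gamma> \<le> integral\<^sup>L \<mu> potential"
    by (rule LIMSEQ_le_const[OF integral_stage_tendsto[OF assms(1)]]) (use \<gamma> in blast)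
  then show ?thesis using \<gamma> by linarith
qed

lemma maximizing_iff: "maximizing (\<lambda>x. - potential x) \<mu> \<longleftrightarrow> \<mu> = bernoulli_half"
proof -
  have le: "integral\<^sup>L \<nu> (\<lambda>x. - potential x) \<le> 0" if "\<nu> \<in> invariant_measures" for \<nu>
    using integral_potential_pos[OF that] mean_potential by (cases "\<nu> = bernoulli_half") auto
  have sup: "(SUP \<nu>\<in>invariant_measures. integral\<^sup>L \<nu> (\<lambda>x. - potential x)) = 0"
    by (rule cSup_eq_maximum) (use le bernoulli_half_invariant mean_potential in \<open>auto intro!: image_eqI[of _ _ bernoulli_half]\<close>)
  show ?thesis
    unfolding maximizing_def sup using integral_potential_pos[of \<mu>] bernoulli_half_invariant mean_potential
    by (cases "\<mu> = bernoulli_half") auto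
qed

section \<open>Walsh coefficients\<close>

lemma walsh_0: "walsh 0 x = 1"
  by (simp add: walsh_def)

lemma walsh_1: "walsh 1 x = (- 1) ^ of_bool (x 0)"
proof -
  have "{j. bit (1 :: nat) j} = {0}" by (auto simp: bit_Suc_0_iff)
  then show ?thesis by (simp add: walsh_def)
qed

lemma abs_walsh: "\<bar>walsh k x\<bar> = 1"
  by (simp add: walsh_def power_abs)

text \<open>
  The low digits of \<open>k\<close> see only the first \<open>m\<close> coordinates and the high digits only the others.  This is
  what lets independence evaluate all integrals of Walsh functions.
\<close>

lemma walsh_split:
  "walsh k x = walsh (take_bit m k) x * walsh (k div 2 ^ m) ((shift ^^ m) x)"
proof -
  have "{j. bit k j} = {j. bit (take_bit m k) j} \<union> (\<lambda>j. j + m) ` {j. bit (k div 2 ^ m) j}" (is "_ = ?A \<union> ?B")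
  proof (intro set_eqI iffI)
    fix j assume j: "j \<in> {j. bit k j}"
    show "j \<in> ?A \<union> ?B"
    proof (cases "j < m")
      case False
      then have "bit (k div 2 ^ m) (j - m)"
        using j by (simp flip: drop_bit_eq_div add: bit_drop_bit_eq)
      then show ?thesis using False by (auto intro!: image_eqI[of _ _ "j - m"])
    qed (use j in \<open>simp add: bit_take_bit_iff\<close>)
  qed (auto simp: bit_take_bit_iff add.commute bit_drop_bit_eq simp flip: drop_bit_eq_div)
  moreover have "?A \<inter> ?B = {}" by (auto simp: bit_take_bit_iff)
  ultimately have "(\<Sum>j | bit k j. of_bool (x j)) = (\<Sum>j\<in>?A. of_bool (x j)) + (\<Sum>j\<in>?B. of_bool (x j) :: nat)"
    by (simp only: sum.union_disjoint finite_bits finite_imageI)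
  also have "(\<Sum>j\<in>?B. of_bool (x j) :: nat) = (\<Sum>j | bit (k div 2 ^ m) j. of_bool (x (j + m)))"
    by (subst sum.reindex) (auto simp: inj_on_def)
  finally show ?thesis by (simp add: walsh_def power_add funpow_shift)
qed

lemma depends_on_walsh:
  assumes "k < 2 ^ N" shows "depends_on N (walsh k)"
  unfolding depends_on_def
proof (intro allI impI)
  fix x y :: "nat \<Rightarrow> bool" assume *: "\<forall>i<N. x i = y i"
  have "j < N" if "bit k j" for j
  proof -
    have "take_bit N k = k" using assms by (simp add: take_bit_nat_eq_self)
    then show ?thesis using that by (metis bit_take_bit_iff)
  qed
  then show "walsh k x = walsh k y"
    unfolding walsh_def using * by (intro arg_cong[where f="\<lambda>n. (- 1) ^ n"] sum.cong) auto
qed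

lemma mean_walsh: "mean (walsh k) = of_bool (k = 0)"
proof (induction k rule: less_induct)
  case (less k)
  interpret prob_space bernoulli_half by (rule prob_space_bernoulli_half)
  have m1: "mean (walsh 1) = 0"
    by (subst mean_eq[OF depends_on_walsh[of 1 1]]) (simp_all add: walsh_1[simplified] bit_Suc_0_iff lessThan_Suc numeral_2_eq_2)
  have m0: "mean (walsh 0) = 1" by (simp add: walsh_0[abs_def] prob_space)
  show ?case
  proof (cases "k = 0")
    case False
    have "k div 2 < 2 ^ (k div 2)" "take_bit 1 k < 2 ^ 1" by (simp_all add: less_exp)
    moreover have "walsh k = (\<lambda>x. walsh (take_bit 1 k) x * walsh (k div 2) ((shift ^^ 1) x))"
      using walsh_split[of k _ 1] by auto
    ultimately have "mean (walsh k) = mean (walsh (take_bit 1 k)) * mean (walsh (k div 2))"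
      using mean_mult_shift[OF depends_on_walsh depends_on_walsh, of "take_bit 1 k" 1 "k div 2" "k div 2"]
      by metis
    also have "\<dots> = 0"
      using False less.IH[of "k div 2"] m0 m1 by (cases "even k") (auto simp: take_bit_eq_mod odd_iff_mod_2_eq_one elim!: evenE)
    finally show ?thesis using False by simp
  qed (simp add: m0)
qed

definition walsh_coeff :: "nat \<Rightarrow> ((nat \<Rightarrow> bool) \<Rightarrow> real) \<Rightarrow> real" where
  "walsh_coeff k f = mean (\<lambda>x. f x * walsh k x)"

lemma walsh_measurable: "walsh k \<in> borel_measurable borel"
  by (rule depends_on_measurable[OF depends_on_walsh[OF less_exp] refl])

lemma integrable_mult_walsh:
  assumes "f \<in> borel_measurable borel" "\<And>x. \<bar>f x\<bar> \<le> C"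
  shows "integrable bernoulli_half (\<lambda>x. f x * walsh k x)"
  by (rule integrable_bounded[OF prob_space_bernoulli_half sets_bernoulli_half, where C=C])
     (use assms walsh_measurable in \<open>auto simp: abs_mult abs_walsh\<close>)

lemma abs_walsh_coeff_le:
  assumes "f \<in> borel_measurable borel" "\<And>x. \<bar>f x\<bar> \<le> C"
  shows "\<bar>walsh_coeff k f\<bar> \<le> C"
  unfolding walsh_coeff_def
  by (rule abs_integral_le[OF prob_space_bernoulli_half sets_bernoulli_half])
     (use assms walsh_measurable in \<open>auto simp: abs_mult abs_walsh\<close>)

lemma walsh_coeff_add:
  assumes "f \<in> borel_measurable borel" "\<And>x. \<bar>f x\<bar> \<le> C" "g \<in> borel_measurable borel" "\<And>x. \<bar>g x\<bar> \<le> D"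
  shows "walsh_coeff k (\<lambda>x. f x + g x) = walsh_coeff k f + walsh_coeff k g"
  unfolding walsh_coeff_def distrib_right
  by (intro Bochner_Integration.integral_add integrable_mult_walsh[OF assms(1,2)] integrable_mult_walsh[OF assms(3,4)])

lemma depends_on_mult_walsh:
  assumes "depends_on R f" "k < 2 ^ R" shows "depends_on R (\<lambda>x. f x * walsh k x)"
  by (rule depends_on_map2[where h="(*)", OF assms(1) depends_on_walsh[OF assms(2)]])

lemma walsh_coeff_vanish:
  assumes f: "depends_on R f" and k: "2 ^ R \<le> k"
  shows "walsh_coeff k f = 0"
proof -
  have "walsh_coeff k f = mean (\<lambda>x. (f x * walsh (take_bit R k) x) * walsh (k div 2 ^ R) ((shift ^^ R) x))"
    unfolding walsh_coeff_def walsh_split[of k _ R] by (simp add: mult.assoc)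
  also have "\<dots> = mean (\<lambda>x. f x * walsh (take_bit R k) x) * mean (walsh (k div 2 ^ R))"
    by (rule mean_mult_shift[OF depends_on_mult_walsh[OF f] depends_on_walsh[OF less_exp]]) simp
  also have "\<dots> = 0" using k by (simp add: mean_walsh div_eq_0_iff)
  finally show ?thesis .
qed

text \<open>
  The factor of \<open>w_k\<close> that belongs to the first \<open>m\<close> coordinates is independent of \<open>f \<circ> T^m\<close> and has
  mean zero unless it is constant.
\<close>

lemma walsh_coeff_shift:
  assumes f: "depends_on R f"
  shows "walsh_coeff k (\<lambda>x. f ((shift ^^ m) x)) = (if 2 ^ m dvd k then walsh_coeff (k div 2 ^ m) f else 0)"
proof -
  define \<kappa> where "\<kappa> = k div 2 ^ m"
  have \<kappa>: "\<kappa> < 2 ^ (R + \<kappa>)" using less_exp[of \<kappa>] by (rule less_le_trans) (auto intro: power_increasing)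
  have g: "depends_on (R + \<kappa>) (\<lambda>x. f x * walsh \<kappa> x)"
    by (rule depends_on_mult_walsh[OF depends_on_mono[OF f] \<kappa>]) simp
  have "walsh_coeff k (\<lambda>x. f ((shift ^^ m) x))
      = mean (\<lambda>x. walsh (take_bit m k) x * (\<lambda>x. f x * walsh \<kappa> x) ((shift ^^ m) x))"
    unfolding walsh_coeff_def walsh_split[of k _ m] \<kappa>_def by (simp add: mult_ac)
  also have "\<dots> = mean (walsh (take_bit m k)) * walsh_coeff \<kappa> f"
    unfolding walsh_coeff_def by (rule mean_mult_shift[OF depends_on_walsh g]) simp
  also have "\<dots> = (if 2 ^ m dvd k then walsh_coeff \<kappa> f else 0)"
    by (simp add: mean_walsh take_bit_eq_mod dvd_eq_mod_eq_0)
  finally show ?thesis by (simp add: \<kappa>_def)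
qed

text \<open>
  The kernel factors as the product over \<open>i < s\<close> of \<open>1 + (-1)^(x_i + y_i)\<close>; each induction step adds
  one factor.  Its nonnegativity is what keeps the partial sums up to \<open>2^s\<close> bounded.
\<close>

lemma walsh_kernel:
  "(\<Sum>k<2 ^ s. walsh k x * walsh k y) = 2 ^ s * of_bool (\<forall>i<s. x i = y i)"
proof (induction s)
  case (Suc s)
  have split: "(\<Sum>k<m + n. g k) = (\<Sum>k<m. g k) + (\<Sum>k<n. g (m + k))" for m n and g :: "nat \<Rightarrow> real"
    by (induction n) (auto simp: add.assoc)
  have top: "walsh (2 ^ s + k) z = walsh k z * (- 1) ^ of_bool (z s)" if "k < 2 ^ s" for k z
  proof -
    have "take_bit s (2 ^ s + k) = k" "(2 ^ s + k) div 2 ^ s = 1" using that by (auto simp: take_bit_eq_mod)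
    then show ?thesis using walsh_split[of "2 ^ s + k" z s] by (simp add: walsh_1[simplified] funpow_shift)
  qed
  have "(\<Sum>k<2 ^ Suc s. walsh k x * walsh k y)
      = (\<Sum>k<2 ^ s. walsh k x * walsh k y) + (\<Sum>k<2 ^ s. walsh (2 ^ s + k) x * walsh (2 ^ s + k) y)"
    by (simp only: power_Suc mult_2 split)
  also have "(\<Sum>k<2 ^ s. walsh (2 ^ s + k) x * walsh (2 ^ s + k) y)
      = (\<Sum>k<2 ^ s. walsh k x * walsh k y) * ((- 1) ^ of_bool (x s) * (- 1) ^ of_bool (y s))"
    unfolding sum_distrib_right by (intro sum.cong) (auto simp: top)
  finally show ?case unfolding Suc.IH by (auto simp: less_Suc_eq)
qed (simp add: walsh_0)

definition walsh_sum :: "nat \<Rightarrow> ((nat \<Rightarrow> bool) \<Rightarrow> real) \<Rightarrow> (nat \<Rightarrow> bool) \<Rightarrow> real" where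
  "walsh_sum n f x = (\<Sum>k<n. walsh_coeff k f * walsh k x)"

lemma agree_eq_cylinder: "{y. \<forall>i<s. x i = y i} = cylinder s (prefix_code s x)"
  by (auto simp: cylinder_def bit_prefix_code)

text \<open>
  The right-hand side is the average of \<open>f\<close> over the cylinder of length \<open>s\<close> around \<open>x\<close>, that is, the
  conditional expectation of \<open>f\<close> given the first \<open>s\<close> coordinates.
\<close>

lemma dyadic_walsh_sum:
  assumes "f \<in> borel_measurable borel" "\<And>x. \<bar>f x\<bar> \<le> C"
  shows "walsh_sum (2 ^ s) f x = 2 ^ s * mean (\<lambda>y. f y * indicator (cylinder s (prefix_code s x)) y)"
proof -
  have "walsh_sum (2 ^ s) f x = mean (\<lambda>y. \<Sum>k<2 ^ s. f y * walsh k y * walsh k x)"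
    unfolding walsh_sum_def walsh_coeff_def
    using integrable_mult_walsh[OF assms] by (subst Bochner_Integration.integral_sum) auto
  also have "\<dots> = mean (\<lambda>y. 2 ^ s * (f y * indicator (cylinder s (prefix_code s x)) y))"
  proof (rule Bochner_Integration.integral_cong[OF refl])
    fix y
    have "(\<Sum>k<2 ^ s. f y * walsh k y * walsh k x) = f y * (\<Sum>k<2 ^ s. walsh k x * walsh k y)"
      by (simp add: sum_distrib_left mult_ac)
    also have "\<dots> = 2 ^ s * (f y * indicator (cylinder s (prefix_code s x)) y)"
      unfolding walsh_kernel by (auto simp: indicator_def simp flip: agree_eq_cylinder)
    finally show "(\<Sum>k<2 ^ s. f y * walsh k y * walsh k x) = 2 ^ s * (f y * indicator (cylinder s (prefix_code s x)) y)" .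
  qed
  finally show ?thesis by simp
qed

lemma abs_dyadic_walsh_sum_le:
  assumes f: "f \<in> borel_measurable borel" "\<And>x. \<bar>f x\<bar> \<le> C"
  shows "\<bar>walsh_sum (2 ^ s) f x\<bar> \<le> C"
proof -
  let ?I = "indicator (cylinder s (prefix_code s x)) :: _ \<Rightarrow> real"
  have I: "?I \<in> borel_measurable borel" using cylinder_sets by simp
  have int: "integrable bernoulli_half (\<lambda>y. f y * ?I y)"
    by (rule integrable_bounded[OF prob_space_bernoulli_half sets_bernoulli_half, where C=C])
       (use borel_measurable_times[OF f(1) I] in \<open>auto simp: indicator_def f(2) intro: order_trans[OF abs_ge_zero f(2)]\<close>)
  have int2: "integrable bernoulli_half (\<lambda>y. C * ?I y)"
    by (intro integrable_mult_right integrable_bounded[OF prob_space_bernoulli_half sets_bernoulli_half I, where C=1])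
       (auto simp: indicator_def)
  have "\<bar>mean (\<lambda>y. f y * ?I y)\<bar> \<le> mean (\<lambda>y. \<bar>f y * ?I y\<bar>)" by (rule integral_abs_bound)
  also have "\<dots> \<le> mean (\<lambda>y. C * ?I y)"
    using int int2 f(2) by (intro integral_mono) (auto simp: indicator_def)
  also have "\<dots> = C * (1 / 2 ^ s)" by (simp only: integral_mult_right_zero mean_indicator_cylinder)
  finally show ?thesis by (simp add: dyadic_walsh_sum[OF f] abs_mult field_simps)
qed

lemma dyadic_walsh_sum_eq:
  assumes f: "depends_on s f" "\<And>x. \<bar>f x\<bar> \<le> C"
  shows "walsh_sum (2 ^ s) f x = f x"
proof -
  let ?I = "indicator (cylinder s (prefix_code s x)) :: _ \<Rightarrow> real"
  have "mean (\<lambda>y. f y * ?I y) = mean (\<lambda>y. f x * ?I y)"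
  proof (rule Bochner_Integration.integral_cong[OF refl])
    fix y
    have "f y = f x" if "y \<in> cylinder s (prefix_code s x)"
      using that by (intro depends_onD[OF f(1)]) (simp flip: agree_eq_cylinder)
    then show "f y * ?I y = f x * ?I y" by (auto simp: indicator_def)
  qed
  also have "\<dots> = f x * (1 / 2 ^ s)"
    by (simp only: integral_mult_right_zero mean_indicator_cylinder)
  finally show ?thesis
    by (simp only: dyadic_walsh_sum[OF depends_on_measurable[OF f(1) refl] f(2)]) simp
qed

section \<open>The Walsh series of the potential\<close>

lemma walsh_coeff_spread_increment:
  "walsh_coeff k (spread_increment j)
    = (\<Sum>i<spread j. walsh_coeff k (\<lambda>x. increment j ((shift ^^ (j + i)) x))) / spread j"
proof -
  have int: "integrable bernoulli_half (\<lambda>x. increment j ((shift ^^ (j + i)) x) * walsh k x)" for i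
    by (rule integrable_mult_walsh[OF depends_on_measurable[OF depends_on_shift[OF depends_on_increment] refl] abs_increment_le])
  show ?thesis
    unfolding walsh_coeff_def spread_increment_def times_divide_eq_left[symmetric] sum_distrib_right
    using int by (simp add: sum_distrib_right)
qed

lemma walsh_coeff_spread_increment_low:
  assumes "1 \<le> k" "k \<le> j" shows "walsh_coeff k (spread_increment j) = 0"
proof -
  have "\<not> 2 ^ (j + i) dvd k" for i
  proof -
    have "k < 2 ^ j" using assms(2) less_exp[of j] by linarith
    also have "(2 :: nat) ^ j \<le> 2 ^ (j + i)" by (intro power_increasing) auto
    finally show ?thesis using assms(1) by (auto dest: dvd_imp_le)
  qed
  then show ?thesis
    by (simp add: walsh_coeff_spread_increment walsh_coeff_shift[OF depends_on_increment])
qed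

text \<open>
  A shift of order \<open>j + i\<close> moves the frequency \<open>\<kappa>\<close> of \<open>increment j\<close> to \<open>\<kappa> * 2^(j+i)\<close>.  For given \<open>\<kappa>\<close> this
  hits the block \<open>2^s \<le> k < 2^(s+1)\<close> for at most one \<open>i\<close>.  Hence at most \<open>spread j\<close> pairs of a shift and
  a frequency contribute, each at most \<open>2^-(j+1) / spread j\<close>.
\<close>

lemma dyadic_block_sum_le:
  "(\<Sum>k\<in>{2 ^ s..<2 ^ Suc s}. \<bar>walsh_coeff k (spread_increment j)\<bar>) \<le> 1 / 2 ^ Suc j"
proof -
  define \<delta> :: real where "\<delta> = 1 / 2 ^ Suc j"
  define I where "I = {..<spread j}"
  define B where "B = {2 ^ s..<(2 :: nat) ^ Suc s}"
  \<comment> \<open>the pairs of a shift \<open>i\<close> and a frequency \<open>k\<close> in the block that can contribute\<close>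
  define P where "P = {(i, k). (i, k) \<in> I \<times> B \<and> 2 ^ (j + i) dvd k \<and> k div 2 ^ (j + i) < spread j}"
  have fin: "finite P" by (rule finite_subset[of _ "I \<times> B"]) (auto simp: P_def I_def B_def)
  have le: "\<bar>walsh_coeff k (\<lambda>x. increment j ((shift ^^ (j + i)) x))\<bar>
      \<le> \<delta> * of_bool (2 ^ (j + i) dvd k \<and> k div 2 ^ (j + i) < spread j)" for i k
    using abs_walsh_coeff_le[OF increment_measurable abs_increment_le, of "k div 2 ^ (j + i)" j]
      walsh_coeff_vanish[OF depends_on_increment[of j], of "k div 2 ^ (j + i)"]
    by (auto simp: walsh_coeff_shift[OF depends_on_increment] \<delta>_def spread_def not_less)
  have inj: "inj_on (\<lambda>(i, k). k div 2 ^ (j + i)) P"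
  proof -
    have "i \<le> i'" if P: "(i, k) \<in> P" "(i', k') \<in> P" and eq: "k div 2 ^ (j + i) = k' div 2 ^ (j + i')" for i k i' k'
    proof (rule ccontr)
      assume "\<not> i \<le> i'"
      then have "Suc (j + i') \<le> j + i" by simp
      then have "(2 :: nat) * 2 ^ (j + i') \<le> 2 ^ (j + i)" unfolding power_Suc[symmetric] by (intro power_increasing) auto
      moreover have "k = k div 2 ^ (j + i) * 2 ^ (j + i)" "k' = k div 2 ^ (j + i) * 2 ^ (j + i')"
        using P eq by (auto simp: P_def)
      ultimately have "2 * k' \<le> k" by (metis mult.left_commute mult_le_mono2)
      then show False using P by (auto simp: P_def B_def)
    qed
    then have "i = i' \<and> k = k'" if "(i, k) \<in> P" "(i', k') \<in> P" "k div 2 ^ (j + i) = k' div 2 ^ (j + i')" for i k i' k'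
    proof -
      have "i = i'" using that \<open>\<And>k' k i' i. \<lbrakk>(i, k) \<in> P; (i', k') \<in> P; k div 2 ^ (j + i) = k' div 2 ^ (j + i')\<rbrakk> \<Longrightarrow> i \<le> i'\<close>
        by (metis order_antisym)
      then show ?thesis using that by (auto simp: P_def elim!: dvdE)
    qed
    then show ?thesis by (auto simp: inj_on_def)
  qed
  have "card P \<le> card {..<spread j}"
    by (rule card_inj_on_le[OF inj]) (auto simp: P_def)
  then have card: "card P \<le> spread j" by simp
  have "(\<Sum>k\<in>B. \<bar>walsh_coeff k (spread_increment j)\<bar>)
      \<le> (\<Sum>k\<in>B. (\<Sum>i\<in>I. \<delta> * of_bool (2 ^ (j + i) dvd k \<and> k div 2 ^ (j + i) < spread j)) / spread j)"
  proof (rule sum_mono)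
    fix k
    show "\<bar>walsh_coeff k (spread_increment j)\<bar>
      \<le> (\<Sum>i\<in>I. \<delta> * of_bool (2 ^ (j + i) dvd k \<and> k div 2 ^ (j + i) < spread j)) / spread j"
      unfolding walsh_coeff_spread_increment I_def abs_divide abs_of_nat
      by (intro divide_right_mono order_trans[OF sum_abs] sum_mono le) simp
  qed
  also have "\<dots> = \<delta> * (\<Sum>k\<in>B. \<Sum>i\<in>I. of_bool (2 ^ (j + i) dvd k \<and> k div 2 ^ (j + i) < spread j)) / spread j"
    by (simp only: sum_divide_distrib[symmetric] sum_distrib_left[symmetric])
  also have "(\<Sum>k\<in>B. \<Sum>i\<in>I. of_bool (2 ^ (j + i) dvd k \<and> k div 2 ^ (j + i) < spread j) :: real)
      = (\<Sum>(i, k)\<in>I \<times> B. of_bool (2 ^ (j + i) dvd k \<and> k div 2 ^ (j + i) < spread j))"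
    by (subst sum.swap) (rule sum.cartesian_product)
  also have "\<dots> = (\<Sum>p\<in>P. 1)"
    by (rule sum.mono_neutral_cong_right) (auto simp: P_def I_def B_def)
  also have "\<dots> = card P" by simp
  also have "\<delta> * card P / spread j \<le> \<delta>"
    using card spread_pos[of j] by (simp add: \<delta>_def field_simps)
  finally show ?thesis by (simp add: \<delta>_def B_def)
qed

lemma walsh_coeff_partial_potential:
  "walsh_coeff k (partial_potential n) = (\<Sum>j<n. walsh_coeff k (spread_increment j))"
proof -
  have "integrable bernoulli_half (\<lambda>x. spread_increment j x * walsh k x)" for j
    by (rule integrable_mult_walsh[OF spread_increment_measurable abs_spread_increment_le])
  then show ?thesis
    unfolding walsh_coeff_def partial_potential_def sum_distrib_right by simp
qed

lemma walsh_coeff_potential_split: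
  "walsh_coeff k potential = walsh_coeff k (partial_potential J) + walsh_coeff k (\<lambda>x. potential x - partial_potential J x)"
proof -
  have "walsh_coeff k (\<lambda>x. partial_potential J x + (potential x - partial_potential J x))
     = walsh_coeff k (partial_potential J) + walsh_coeff k (\<lambda>x. potential x - partial_potential J x)"
    by (rule walsh_coeff_add[OF partial_potential_measurable abs_partial_potential_le _ potential_tail])
       (intro borel_measurable_diff potential_measurable partial_potential_measurable)
  then show ?thesis by simp
qed

text \<open>
  For \<open>k \<ge> 1\<close>, the summands of the potential with index at least \<open>k\<close> are orthogonal to \<open>w_k\<close>.
\<close>

lemma walsh_coeff_potential:
  assumes "1 \<le> k" "k \<le> n"
  shows "walsh_coeff k potential = (\<Sum>j<n. walsh_coeff k (spread_increment j))"
proof -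
  have same: "walsh_coeff k (partial_potential J) = walsh_coeff k (partial_potential n)" if "n \<le> J" for J
    unfolding walsh_coeff_partial_potential using that assms
    by (intro sum.mono_neutral_right) (auto intro!: walsh_coeff_spread_increment_low)
  have "\<bar>walsh_coeff k potential - walsh_coeff k (partial_potential n)\<bar> \<le> 1 / 2 ^ J" if "n \<le> J" for J
  proof -
    have "\<bar>walsh_coeff k (\<lambda>x. potential x - partial_potential J x)\<bar> \<le> 1 / 2 ^ J"
      by (rule abs_walsh_coeff_le[OF _ potential_tail])
         (intro borel_measurable_diff potential_measurable partial_potential_measurable)
    then show ?thesis using walsh_coeff_potential_split[of k J] same[OF that] by simp
  qed
  moreover have "(\<lambda>J. 1 / 2 ^ J :: real) \<longlonglongrightarrow> 0" by real_asymp
  ultimately have "\<bar>walsh_coeff k potential - walsh_coeff k (partial_potential n)\<bar> \<le> 0"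
    by (intro LIMSEQ_le_const) auto
  then show ?thesis by (simp add: walsh_coeff_partial_potential)
qed

text \<open>
  Split the potential into a partial sum \<open>partial_potential J\<close>, which the Walsh sums of order \<open>2^s\<close>
  reproduce exactly, and a remainder \<open>h\<close> of size at most \<open>2^-J\<close>.  The Walsh sum of order \<open>2^s\<close> of \<open>h\<close>
  costs another \<open>2^-J\<close>, and so do the terms between \<open>2^s\<close> and \<open>K\<close>, whose coefficients come from the
  increments with index at least \<open>J\<close> only.
\<close>

lemma walsh_series_error:
  assumes R: "depends_on R (partial_potential J)" and K: "2 ^ R \<le> K"
  shows "\<bar>walsh_sum (Suc K) potential x - potential x\<bar> \<le> 3 / 2 ^ J"
proof -
  define s where "s = floor_log K"
  define h where "h x = potential x - partial_potential J x" for x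
  have "0 < (2 :: nat) ^ R" by simp
  then have "K \<noteq> 0" using K by linarith
  then have s: "2 ^ s \<le> K" "K < 2 ^ Suc s"
    using floor_log_exp2_le[of K] floor_log_exp2_gt[of K] by (auto simp: s_def)
  have "R \<le> s" using floor_log_le_iff[OF K] by (simp add: s_def)
  then have Rs: "depends_on s (partial_potential J)" by (rule depends_on_mono[OF R])
  have h: "h \<in> borel_measurable borel" "\<And>x. \<bar>h x\<bar> \<le> 1 / 2 ^ J"
    unfolding h_def[abs_def] using potential_tail
    by (auto intro: borel_measurable_diff potential_measurable partial_potential_measurable)
  have "walsh_sum (2 ^ s) potential x = walsh_sum (2 ^ s) (partial_potential J) x + walsh_sum (2 ^ s) h x"
    unfolding walsh_sum_def h_def[abs_def] walsh_coeff_potential_split[of _ J]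
    by (simp add: distrib_right sum.distrib)
  then have 1: "walsh_sum (2 ^ s) potential x - potential x = walsh_sum (2 ^ s) h x - h x"
    using dyadic_walsh_sum_eq[OF Rs abs_partial_potential_le] by (simp add: h_def)
  have potential_coeff: "\<bar>walsh_coeff k potential\<bar> \<le> (\<Sum>j\<in>{J..<J + 2 ^ Suc s}. \<bar>walsh_coeff k (spread_increment j)\<bar>)"
    if k: "k \<in> {2 ^ s..<2 ^ Suc s}" for k
  proof -
    have "1 \<le> k" using k one_le_power[of "2 :: nat" s] by auto
    then have "walsh_coeff k potential = (\<Sum>j<J + 2 ^ Suc s. walsh_coeff k (spread_increment j))"
      using k by (intro walsh_coeff_potential) auto
    also have "\<dots> = (\<Sum>j<J. walsh_coeff k (spread_increment j)) + (\<Sum>j\<in>{J..<J + 2 ^ Suc s}. walsh_coeff k (spread_increment j))"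
      unfolding lessThan_atLeast0 by (rule sum.atLeastLessThan_concat[symmetric]) auto
    also have "(\<Sum>j<J. walsh_coeff k (spread_increment j)) = 0"
      using walsh_coeff_vanish[OF Rs, of k] k by (simp add: walsh_coeff_partial_potential)
    finally show ?thesis by simp
  qed
  have geo: "(\<Sum>j\<in>{J..<J + n}. 1 / 2 ^ Suc j :: real) = 1 / 2 ^ J - 1 / 2 ^ (J + n)" for n
  proof (induction n)
    case (Suc n)
    have "1 / 2 ^ (J + n) = 1 / 2 ^ Suc (J + n) + (1 / 2 ^ Suc (J + n) :: real)" by simp
    then show ?case using Suc.IH by (simp only: add_Suc_right sum.atLeastLessThan_Suc le_add1)
  qed simp
  have "walsh_sum (Suc K) potential x - walsh_sum (2 ^ s) potential x = (\<Sum>k\<in>{2 ^ s..<Suc K}. walsh_coeff k potential * walsh k x)"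
    using s unfolding walsh_sum_def lessThan_atLeast0
    by (subst sum.atLeastLessThan_concat[symmetric, of 0 "2 ^ s" "Suc K"]) auto
  also have "\<bar>\<dots>\<bar> \<le> (\<Sum>k\<in>{2 ^ s..<Suc K}. \<bar>walsh_coeff k potential\<bar>)"
    by (rule order_trans[OF sum_abs]) (simp add: abs_mult abs_walsh)
  also have "\<dots> \<le> (\<Sum>k\<in>{2 ^ s..<2 ^ Suc s}. \<bar>walsh_coeff k potential\<bar>)"
    using s by (intro sum_mono2) auto
  also have "\<dots> \<le> (\<Sum>k\<in>{2 ^ s..<2 ^ Suc s}. \<Sum>j\<in>{J..<J + 2 ^ Suc s}. \<bar>walsh_coeff k (spread_increment j)\<bar>)"
    by (intro sum_mono potential_coeff)
  also have "\<dots> = (\<Sum>j\<in>{J..<J + 2 ^ Suc s}. \<Sum>k\<in>{2 ^ s..<2 ^ Suc s}. \<bar>walsh_coeff k (spread_increment j)\<bar>)"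
    by (rule sum.swap)
  also have "\<dots> \<le> (\<Sum>j\<in>{J..<J + 2 ^ Suc s}. 1 / 2 ^ Suc j)"
    by (intro sum_mono dyadic_block_sum_le)
  also have "\<dots> \<le> 1 / 2 ^ J" unfolding geo by simp
  finally have "\<bar>walsh_sum (Suc K) potential x - walsh_sum (2 ^ s) potential x\<bar> \<le> 1 / 2 ^ J" .
  moreover have "\<bar>walsh_sum (2 ^ s) h x - h x\<bar> \<le> 2 * (1 / 2 ^ J)"
    using abs_dyadic_walsh_sum_le[OF h, of s x] h(2)[of x] by linarith
  ultimately show ?thesis using 1 by (simp add: abs_le_iff)
qed

section \<open>Closure properties of the recursive functions\<close>

text \<open>
  The predicate \<^const>\<open>recursive\<close> fixes the values on lists of the wrong length, where they
  carry no meaning.  Closing it under agreement on lists of length \<open>n\<close> allows functions to be written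
  as ordinary expressions in the entries of the argument list.
\<close>

definition computable :: "nat \<Rightarrow> (nat list \<Rightarrow> nat) \<Rightarrow> bool" where
  "computable n f \<longleftrightarrow> (\<exists>g. recursive n g \<and> (\<forall>xs. length xs = n \<longrightarrow> g xs = f xs))"

lemma computable_cong:
  assumes "computable n f" "\<And>xs. length xs = n \<Longrightarrow> f xs = g xs"
  shows "computable n g"
  using assms unfolding computable_def by metis

lemma recursive_imp_computable: "recursive n f \<Longrightarrow> computable n f"
  unfolding computable_def by blast

lemma computable_proj: "i < n \<Longrightarrow> computable n (\<lambda>xs. xs ! i)"
  by (intro recursive_imp_computable recursive.proj)

lemma computable_comp:
  assumes f: "computable (length gs) f" and gs: "\<forall>g\<in>set gs. computable n g"
  shows "computable n (\<lambda>xs. f (map (\<lambda>g. g xs) gs))"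
proof -
  obtain f' where f': "recursive (length gs) f'" "\<And>xs. length xs = length gs \<Longrightarrow> f' xs = f xs"
    using f unfolding computable_def by blast
  have "\<forall>g\<in>set gs. \<exists>g'. recursive n g' \<and> (\<forall>xs. length xs = n \<longrightarrow> g' xs = g xs)"
    using gs unfolding computable_def by blast
  then obtain h where h: "\<forall>g\<in>set gs. recursive n (h g) \<and> (\<forall>xs. length xs = n \<longrightarrow> h g xs = g xs)"
    by metis
  have "recursive n (\<lambda>xs. f' (map (\<lambda>g. g xs) (map h gs)))"
    using f'(1) h by (intro recursive.comp[where m="length gs"]) auto
  moreover have "f' (map (\<lambda>g. g xs) (map h gs)) = f (map (\<lambda>g. g xs) gs)" if "length xs = n" for xs
  proof -
    have "map (\<lambda>g. g xs) (map h gs) = map (\<lambda>g. g xs) gs" using h that by auto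
    then show ?thesis using f'(2)[of "map (\<lambda>g. g xs) gs"] by (simp only: length_map)
  qed
  ultimately show ?thesis unfolding computable_def by blast
qed

lemma computable_comp1:
  assumes "computable 1 (\<lambda>ys. f (ys ! 0))" "computable n g"
  shows "computable n (\<lambda>xs. f (g xs))"
  using computable_comp[of "[g]" "\<lambda>ys. f (ys ! 0)" n] assms by simp

lemma computable_comp2:
  assumes "computable 2 (\<lambda>ys. f (ys ! 0) (ys ! 1))" "computable n g" "computable n h"
  shows "computable n (\<lambda>xs. f (g xs) (h xs))"
  using computable_comp[of "[g, h]" "\<lambda>ys. f (ys ! 0) (ys ! 1)" n] assms
  by (simp add: numeral_2_eq_2)

lemma computable_Suc: "computable n g \<Longrightarrow> computable n (\<lambda>xs. Suc (g xs))"
  by (rule computable_comp1[where f=Suc, OF recursive_imp_computable[OF recursive.succ]])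

lemma computable_const: "computable n (\<lambda>_. c)"
proof (induction c)
  case 0
  show ?case by (intro recursive_imp_computable recursive.zero)
qed (rule computable_Suc)

text \<open>
  The side condition on \<open>h'\<close> lets the recursion step be given as an expression in its arguments, while
  \<open>h\<close> is the same expression in terms of the entries of one list.  The same device is used for the
  bounded sums and products below.
\<close>

lemma computable_rec:
  assumes f: "computable n f" and h: "computable (Suc (Suc n)) h" and e: "computable n e"
    and h': "\<And>y r xs. length xs = n \<Longrightarrow> h' y r xs = h (y # r # xs)"
  shows "computable n (\<lambda>xs. rec_nat (f xs) (\<lambda>y r. h' y r xs) (e xs))"
proof -
  obtain f0 where f0: "recursive n f0" "\<And>xs. length xs = n \<Longrightarrow> f0 xs = f xs"
    using f unfolding computable_def by blast
  obtain h0 where h0: "recursive (Suc (Suc n)) h0" "\<And>xs. length xs = Suc (Suc n) \<Longrightarrow> h0 xs = h xs"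
    using h unfolding computable_def by blast
  define R where "R = (\<lambda>xs. rec_nat (f0 (tl xs)) (\<lambda>y r. h0 (y # r # tl xs)) (hd xs))"
  have R: "computable (Suc n) R"
    unfolding R_def using recursive.prim_rec[OF f0(1) h0(1)] by (rule recursive_imp_computable)
  let ?gs = "e # map (\<lambda>i xs. xs ! i) [0..<n]"
  have "computable n (\<lambda>xs. R (map (\<lambda>g. g xs) ?gs))"
    using R e by (intro computable_comp) (auto intro: computable_proj)
  then show ?thesis
  proof (rule computable_cong)
    fix xs :: "nat list" assume len: "length xs = n"
    have "map (\<lambda>g. g xs) ?gs = e xs # xs"
      using len map_nth[of xs] by (simp add: comp_def)
    then show "R (map (\<lambda>g. g xs) ?gs) = rec_nat (f xs) (\<lambda>y r. h' y r xs) (e xs)"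
      using len by (simp add: R_def f0 h0 h')
  qed
qed

lemma computable_add:
  assumes "computable n f" "computable n g" shows "computable n (\<lambda>xs. f xs + g xs)"
proof (rule computable_comp2[OF _ assms, where f="(+)"])
  have "computable 2 (\<lambda>xs. rec_nat (xs ! 1) (\<lambda>y r. Suc r) (xs ! 0))"
    by (rule computable_rec[where h="\<lambda>ys. Suc (ys ! 1)"]) (auto simp: computable_proj computable_Suc)
  moreover have "rec_nat b (\<lambda>y r. Suc r) a = a + b" for a b by (induction a) auto
  ultimately show "computable 2 (\<lambda>xs. xs ! 0 + xs ! 1)" by simp
qed

lemma computable_mult:
  assumes "computable n f" "computable n g" shows "computable n (\<lambda>xs. f xs * g xs)"
proof (rule computable_comp2[OF _ assms, where f="(*)"])
  have "computable 2 (\<lambda>xs. rec_nat 0 (\<lambda>y r. r + xs ! 1) (xs ! 0))"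
    by (rule computable_rec[where h="\<lambda>ys. ys ! 1 + ys ! 3"])
       (auto simp: computable_proj computable_add computable_const)
  moreover have "rec_nat 0 (\<lambda>y r. r + b) a = a * b" for a b :: nat by (induction a) auto
  ultimately show "computable 2 (\<lambda>xs. xs ! 0 * xs ! 1)" by simp
qed

lemma computable_power:
  assumes "computable n f" "computable n g" shows "computable n (\<lambda>xs. f xs ^ g xs)"
proof (rule computable_comp2[OF _ assms, where f="(^)"])
  have "computable 2 (\<lambda>xs. rec_nat 1 (\<lambda>y r. r * xs ! 0) (xs ! 1))"
    by (rule computable_rec[where h="\<lambda>ys. ys ! 1 * ys ! 2"])
       (auto simp: computable_proj computable_mult computable_const)
  moreover have "rec_nat 1 (\<lambda>y r. r * a) b = a ^ b" for a b :: nat by (induction b) auto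
  ultimately show "computable 2 (\<lambda>xs. xs ! 0 ^ xs ! 1)" by simp
qed

lemma computable_diff:
  assumes "computable n f" "computable n g" shows "computable n (\<lambda>xs. f xs - g xs)"
proof (rule computable_comp2[OF _ assms, where f="(-)"])
  have "computable 1 (\<lambda>xs. rec_nat 0 (\<lambda>y r. y) (xs ! 0))"
    by (rule computable_rec[where h="\<lambda>ys. ys ! 0"]) (auto intro!: computable_proj computable_const)
  moreover have "rec_nat 0 (\<lambda>y r. y) a = a - 1" for a :: nat by (cases a) auto
  ultimately have pred: "computable 1 (\<lambda>xs. xs ! 0 - 1)" by simp
  have "computable 2 (\<lambda>xs. rec_nat (xs ! 0) (\<lambda>y r. r - 1) (xs ! 1))"
    using computable_comp1[where f="\<lambda>a. a - 1", OF pred]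
    by (intro computable_rec[where h="\<lambda>ys. ys ! 1 - 1"]) (auto simp: computable_proj)
  moreover have "rec_nat a (\<lambda>y r. r - 1) b = a - b" for a b :: nat by (induction b) auto
  ultimately show "computable 2 (\<lambda>xs. xs ! 0 - xs ! 1)" by simp
qed

lemma computable_sum:
  assumes "computable n b" "computable (Suc n) g"
    and "\<And>i xs. length xs = n \<Longrightarrow> f i xs = g (i # xs)"
  shows "computable n (\<lambda>xs. \<Sum>i<b xs. f i xs)"
proof -
  let ?gs = "(\<lambda>xs. xs ! 0) # map (\<lambda>i xs. xs ! Suc (Suc i)) [0..<n]"
  have "computable (Suc (Suc n)) (\<lambda>xs. g (map (\<lambda>g. g xs) ?gs))"
    using assms(2) by (intro computable_comp) (auto intro!: computable_proj)
  then have g: "computable (Suc (Suc n)) (\<lambda>xs. xs ! 1 + g (map (\<lambda>g. g xs) ?gs))"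
    by (intro computable_add computable_proj) auto
  have "computable n (\<lambda>xs. rec_nat 0 (\<lambda>y r. r + f y xs) (b xs))"
  proof (rule computable_rec[OF computable_const g assms(1)])
    fix y r :: nat and xs :: "nat list" assume "length xs = n"
    then show "r + f y xs = (y # r # xs) ! 1 + g (map (\<lambda>g. g (y # r # xs)) ?gs)"
      using map_nth[of xs] by (simp add: assms(3) comp_def)
  qed
  moreover have "rec_nat 0 (\<lambda>y r. r + f y xs) b = (\<Sum>i<b. f i xs)" for b xs by (induction b) auto
  ultimately show ?thesis by simp
qed

lemma computable_prod:
  assumes "computable n b" "computable (Suc n) g"
    and "\<And>i xs. length xs = n \<Longrightarrow> f i xs = g (i # xs)"
  shows "computable n (\<lambda>xs. \<Prod>i<b xs. f i xs)"
proof -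
  let ?gs = "(\<lambda>xs. xs ! 0) # map (\<lambda>i xs. xs ! Suc (Suc i)) [0..<n]"
  have "computable (Suc (Suc n)) (\<lambda>xs. g (map (\<lambda>g. g xs) ?gs))"
    using assms(2) by (intro computable_comp) (auto intro!: computable_proj)
  then have g: "computable (Suc (Suc n)) (\<lambda>xs. xs ! 1 * g (map (\<lambda>g. g xs) ?gs))"
    by (intro computable_mult computable_proj) auto
  have "computable n (\<lambda>xs. rec_nat 1 (\<lambda>y r. r * f y xs) (b xs))"
  proof (rule computable_rec[OF computable_const g assms(1)])
    fix y r :: nat and xs :: "nat list" assume "length xs = n"
    then show "r * f y xs = (y # r # xs) ! 1 * g (map (\<lambda>g. g (y # r # xs)) ?gs)"
      using map_nth[of xs] by (simp add: assms(3) comp_def)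
  qed
  moreover have "rec_nat 1 (\<lambda>y r. r * f y xs) b = (\<Prod>i<b. f i xs)" for b xs by (induction b) auto
  ultimately show ?thesis by simp
qed

lemmas computable_intros = computable_const computable_Suc computable_add computable_mult
  computable_diff computable_power computable_proj

lemma sum_of_bool_less: "(\<Sum>i<a. of_bool (i < m)) = (min a m :: nat)"
  by (induction a) auto

lemma computable_of_bool_le:
  assumes "computable n f" "computable n g" shows "computable n (\<lambda>xs. of_bool (f xs \<le> g xs))"
proof -
  have "of_bool (a \<le> b) = 1 - (a - b)" for a b :: nat by auto
  then show ?thesis using assms by (simp add: computable_intros)
qed

lemma computable_of_bool_eq:
  assumes "computable n f" "computable n g" shows "computable n (\<lambda>xs. of_bool (f xs = g xs))"
proof -
  have "of_bool (a = b) = 1 - ((a - b) + (b - a))" for a b :: nat by auto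
  then show ?thesis using assms by (simp add: computable_intros)
qed

lemma computable_div:
  assumes "computable n f" "computable n g" shows "computable n (\<lambda>xs. f xs div g xs)"
proof (rule computable_comp2[OF _ assms, where f="(div)"])
  have div: "a div b = (\<Sum>i<a. of_bool (Suc i * b \<le> a)) * of_bool (1 \<le> b)" for a b :: nat
  proof (cases "b = 0")
    case False
    \<comment> \<open>the quotient counts the positive multiples of \<open>b\<close> up to \<open>a\<close>\<close>
    have "(Suc i * b \<le> a) \<longleftrightarrow> i < a div b" for i
      using False by (simp add: less_eq_div_iff_mult_less_eq flip: Suc_le_eq)
    then show ?thesis using False by (simp add: sum_of_bool_less)
  qed simp
  have "computable 2 (\<lambda>xs. (\<Sum>i<xs!0. of_bool (Suc i * xs ! 1 \<le> xs ! 0)) * of_bool (1 \<le> xs ! 1))"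
    by (intro computable_mult computable_sum[where g="\<lambda>ys. of_bool (Suc (ys ! 0) * ys ! 2 \<le> ys ! 1)"]
        computable_of_bool_le computable_intros) auto
  then show "computable 2 (\<lambda>xs. xs ! 0 div xs ! 1)"
    by (simp only: div)
qed

lemma computable_mod:
  assumes "computable n f" "computable n g" shows "computable n (\<lambda>xs. f xs mod g xs)"
  using assms by (simp only: minus_mult_div_eq_mod[symmetric] computable_intros computable_div)

lemma computable_floor_log:
  assumes "computable n f" shows "computable n (\<lambda>xs. floor_log (f xs))"
proof (rule computable_comp1[OF _ assms])
  have "floor_log a = (\<Sum>i<a. of_bool (2 ^ Suc i \<le> a))" for a
  proof (cases "a = 0")
    case False
    have "(2 ^ Suc i \<le> a) \<longleftrightarrow> i < floor_log a" for i
      using floor_log_le_iff[of a] False floor_log_exp2_le[of a] floor_log_exp2_gt[of a]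
      by (metis Suc_le_eq floor_log_power floor_log_mono gr0I monoD order_trans power_increasing one_le_numeral)
    moreover have "floor_log a \<le> a"
      using floor_log_exp2_le[of a] False less_exp[of "floor_log a"] by linarith
    ultimately show ?thesis by (simp add: sum_of_bool_less del: power_Suc)
  qed simp
  moreover have "computable 1 (\<lambda>xs. \<Sum>i<xs!0. of_bool (2 ^ Suc i \<le> xs ! 0))"
    by (intro computable_sum[where g="\<lambda>ys. of_bool (2 ^ Suc (ys ! 0) \<le> ys ! 1)"]
        computable_of_bool_le computable_intros) auto
  ultimately show "computable 1 (\<lambda>xs. floor_log (xs ! 0))" by simp
qed

definition computable_rat :: "nat \<Rightarrow> (nat list \<Rightarrow> rat) \<Rightarrow> bool" where
  "computable_rat n f \<longleftrightarrow> (\<exists>p q d. computable n p \<and> computable n q \<and> computable n d \<and>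
     (\<forall>xs. length xs = n \<longrightarrow> d xs \<noteq> 0 \<and> f xs = (of_nat (p xs) - of_nat (q xs)) / of_nat (d xs)))"

lemma computable_ratI:
  assumes "computable n p" "computable n q" "computable n d"
    and "\<And>xs. length xs = n \<Longrightarrow> d xs \<noteq> 0"
    and "\<And>xs. length xs = n \<Longrightarrow> f xs = (of_nat (p xs) - of_nat (q xs)) / of_nat (d xs)"
  shows "computable_rat n f"
  using assms unfolding computable_rat_def by blast

lemma computable_rat_seq_iff:
  "computable_rat_seq c \<longleftrightarrow> computable_rat 1 (\<lambda>xs. c (xs ! 0))"
proof
  assume "computable_rat_seq c"
  then obtain p q d where "recursive 1 p" "recursive 1 q" "recursive 1 d"
      "\<forall>k. d [k] \<noteq> 0 \<and> c k = (of_nat (p [k]) - of_nat (q [k])) / of_nat (d [k])"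
    unfolding computable_rat_seq_def by blast
  then show "computable_rat 1 (\<lambda>xs. c (xs ! 0))"
    by (intro computable_ratI[of 1 p q d]) (auto intro: recursive_imp_computable simp: length_Suc_conv)
next
  assume "computable_rat 1 (\<lambda>xs. c (xs ! 0))"
  then obtain p q d where "computable 1 p" "computable 1 q" "computable 1 d"
    and *: "\<forall>xs. length xs = 1 \<longrightarrow> d xs \<noteq> 0 \<and> c (xs ! 0) = (of_nat (p xs) - of_nat (q xs)) / of_nat (d xs)"
    unfolding computable_rat_def by blast
  then obtain p' q' d' where r: "recursive 1 p'" "recursive 1 q'" "recursive 1 d'"
    and e: "\<And>xs. length xs = 1 \<Longrightarrow> p' xs = p xs" "\<And>xs. length xs = 1 \<Longrightarrow> q' xs = q xs"
      "\<And>xs. length xs = 1 \<Longrightarrow> d' xs = d xs"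
    unfolding computable_def by metis
  have "d' [k] \<noteq> 0 \<and> c k = (of_nat (p' [k]) - of_nat (q' [k])) / of_nat (d' [k])" for k
    using *[rule_format, of "[k]"] e[of "[k]"] by simp
  with r show "computable_rat_seq c"
    unfolding computable_rat_seq_def by blast
qed

lemma computable_rat_of_nat: "computable n f \<Longrightarrow> computable_rat n (\<lambda>xs. of_nat (f xs))"
  by (rule computable_ratI[of n f "\<lambda>_. 0" "\<lambda>_. 1"]) (auto intro: computable_intros)

lemma computable_rat_diff:
  assumes "computable_rat n f" "computable_rat n g"
  shows "computable_rat n (\<lambda>xs. f xs - g xs)"
proof -
  obtain p q d where f: "computable n p" "computable n q" "computable n d"
    "\<forall>xs. length xs = n \<longrightarrow> d xs \<noteq> 0 \<and> f xs = (of_nat (p xs) - of_nat (q xs)) / of_nat (d xs)"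
    using assms(1) unfolding computable_rat_def by blast
  obtain p' q' d' where g: "computable n p'" "computable n q'" "computable n d'"
    "\<forall>xs. length xs = n \<longrightarrow> d' xs \<noteq> 0 \<and> g xs = (of_nat (p' xs) - of_nat (q' xs)) / of_nat (d' xs)"
    using assms(2) unfolding computable_rat_def by blast
  show ?thesis
    by (rule computable_ratI[of n "\<lambda>xs. p xs * d' xs + q' xs * d xs"
          "\<lambda>xs. q xs * d' xs + p' xs * d xs" "\<lambda>xs. d xs * d' xs"])
       (use f g in \<open>auto intro: computable_intros simp: field_simps\<close>)
qed

lemma computable_rat_mult:
  assumes "computable_rat n f" "computable_rat n g"
  shows "computable_rat n (\<lambda>xs. f xs * g xs)"
proof -
  obtain p q d where f: "computable n p" "computable n q" "computable n d"
    "\<forall>xs. length xs = n \<longrightarrow> d xs \<noteq> 0 \<and> f xs = (of_nat (p xs) - of_nat (q xs)) / of_nat (d xs)"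
    using assms(1) unfolding computable_rat_def by blast
  obtain p' q' d' where g: "computable n p'" "computable n q'" "computable n d'"
    "\<forall>xs. length xs = n \<longrightarrow> d' xs \<noteq> 0 \<and> g xs = (of_nat (p' xs) - of_nat (q' xs)) / of_nat (d' xs)"
    using assms(2) unfolding computable_rat_def by blast
  show ?thesis
    by (rule computable_ratI[of n "\<lambda>xs. p xs * p' xs + q xs * q' xs"
          "\<lambda>xs. p xs * q' xs + q xs * p' xs" "\<lambda>xs. d xs * d' xs"])
       (use f g in \<open>auto intro: computable_intros simp: field_simps\<close>)
qed

lemma computable_rat_divide:
  assumes "computable_rat n f" "computable n e" "\<And>xs. length xs = n \<Longrightarrow> e xs \<noteq> 0"
  shows "computable_rat n (\<lambda>xs. f xs / of_nat (e xs))"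
proof -
  obtain p q d where f: "computable n p" "computable n q" "computable n d"
    "\<forall>xs. length xs = n \<longrightarrow> d xs \<noteq> 0 \<and> f xs = (of_nat (p xs) - of_nat (q xs)) / of_nat (d xs)"
    using assms(1) unfolding computable_rat_def by blast
  show ?thesis
    by (rule computable_ratI[of n p q "\<lambda>xs. d xs * e xs"])
       (use f assms in \<open>auto intro: computable_intros\<close>)
qed

text \<open>
  The product \<open>P\<close> of all denominators serves as the common denominator.
\<close>

lemma computable_rat_sum:
  assumes b: "computable n b" and g: "computable_rat (Suc n) g"
    and f: "\<And>i xs. length xs = n \<Longrightarrow> f i xs = g (i # xs)"
  shows "computable_rat n (\<lambda>xs. \<Sum>i<b xs. f i xs)"
proof -
  obtain p q d where g: "computable (Suc n) p" "computable (Suc n) q" "computable (Suc n) d"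
    "\<forall>xs. length xs = Suc n \<longrightarrow> d xs \<noteq> 0 \<and> g xs = (of_nat (p xs) - of_nat (q xs)) / of_nat (d xs)"
    using g unfolding computable_rat_def by blast
  define P where "P xs = (\<Prod>i<b xs. d (i # xs))" for xs
  have P: "computable n P"
    unfolding P_def by (rule computable_prod[OF b g(3)]) auto
  let ?gs = "map (\<lambda>i xs. xs ! Suc i) [0..<n]"
  have "computable (Suc n) (\<lambda>xs. P (map (\<lambda>g. g xs) ?gs))"
    using P by (intro computable_comp) (auto intro!: computable_proj)
  then have P': "computable (Suc n) (\<lambda>xs. P (tl xs))"
  proof (rule computable_cong)
    fix xs :: "nat list" assume "length xs = Suc n"
    then show "P (map (\<lambda>g. g xs) ?gs) = P (tl xs)"
      using map_nth[of "tl xs"] by (cases xs) (auto simp: comp_def)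
  qed
  define num where "num r xs = (\<Sum>i<b xs. r (i # xs) * (P xs div d (i # xs)))" for r xs
  have num: "computable n (num r)" if "computable (Suc n) r" for r
    unfolding num_def
    by (rule computable_sum[OF b, where g="\<lambda>ys. r ys * (P (tl ys) div d ys)"])
       (use that P' g in \<open>auto intro: computable_mult computable_div\<close>)
  show ?thesis
  proof (rule computable_ratI[OF num[OF g(1)] num[OF g(2)] P])
    fix xs :: "nat list" assume len: "length xs = n"
    show "P xs \<noteq> 0" using len g(4) by (auto simp: P_def)
    have *: "of_nat (P xs div d (i # xs)) = (of_nat (P xs) / of_nat (d (i # xs)) :: rat)"
      if "i < b xs" for i
      using that len g(4) unfolding P_def
      by (intro of_nat_of_nat_div) auto
    have "(of_nat (num p xs) - of_nat (num q xs) :: rat)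
        = (\<Sum>i<b xs. (of_nat (p (i # xs)) - of_nat (q (i # xs))) * (of_nat (P xs) / of_nat (d (i # xs))))"
      unfolding num_def by (simp add: * left_diff_distrib diff_divide_distrib flip: sum_subtractf)
    also have "\<dots> = (\<Sum>i<b xs. f i xs) * of_nat (P xs)"
      unfolding sum_distrib_right using len by (intro sum.cong) (auto simp: f g(4))
    finally show "(\<Sum>i<b xs. f i xs) = (of_nat (num p xs) - of_nat (num q xs)) / of_nat (P xs)"
      using \<open>P xs \<noteq> 0\<close> by simp
  qed
qed

section \<open>Computing the coefficients\<close>

text \<open>
  The numerators of the stages over the denominators \<open>denom j\<close>, as functions of the code of a point.
  Shifting a point divides its code by a power of two, and truncated subtraction of natural
  numbers plays the role of the positive parts.
\<close>

primrec stage_num :: "nat \<Rightarrow> nat \<Rightarrow> nat" where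
  "stage_num 0 u = 0"
| "stage_num (Suc j) u =
    (\<Sum>i<repeats j. stage_num j (u div 2 ^ (window j * i)))
    + (denom j div 2 ^ Suc j) *
      ((\<Sum>i<repeats j. of_bool (u div 2 ^ (window j * i) mod 2 ^ word_len j = word j mod 2 ^ word_len j))
         - repeats j div 2 ^ word_len j)
    - denom (Suc j) div 4 ^ Suc j"

definition rat_increment :: "nat \<Rightarrow> nat \<Rightarrow> rat" where
  "rat_increment j u = (of_nat (stage_num (Suc j) u)
      - of_nat (\<Sum>i<repeats j. stage_num j (u div 2 ^ (window j * i)))) / of_nat (denom (Suc j))"

text \<open>
  The sum runs to \<open>k\<close> since all binary digits of \<open>k\<close> have positions below \<open>k\<close>.
\<close>

definition walsh_exponent :: "nat \<Rightarrow> nat \<Rightarrow> nat" where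
  "walsh_exponent k u = (\<Sum>i<k. (k div 2 ^ i mod 2) * (u div 2 ^ i mod 2))"

text \<open>
  The \<open>k\<close>-th Walsh coefficient of \<open>increment j \<circ> T^m\<close> as an average over sample points: the product of
  this function with \<open>w_k\<close> depends only on the first \<open>k + m + window (j+1)\<close> coordinates.
\<close>

definition increment_coeff :: "nat \<Rightarrow> nat \<Rightarrow> nat \<Rightarrow> rat" where
  "increment_coeff k j m =
    (\<Sum>u<2 ^ (k + m + window (Suc j)). rat_increment j (u div 2 ^ m) * (- 1) ^ walsh_exponent k u)
      / of_nat (2 ^ (k + m + window (Suc j)))"

definition potential_coeff :: "nat \<Rightarrow> rat" where
  "potential_coeff k = - (\<Sum>j<k. (\<Sum>i<spread j. increment_coeff k j (j + i)) / of_nat (spread j))"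

lemma window_mono: "i \<le> j \<Longrightarrow> window i \<le> window j"
  unfolding window_def by (intro power_increasing mult_le_mono) auto

lemma stage_num_eq: "real (stage_num j u) = denom j * stage j (bit u)"
proof (induction j arbitrary: u)
  case (Suc j)
  define n where "n = repeats j"
  define \<sigma> where "\<sigma> = (\<Sum>i<n. stage j (bit (u div 2 ^ (window j * i))))"
  define \<tau> where "\<tau> = (\<Sum>i<n. of_bool (u div 2 ^ (window j * i) mod 2 ^ word_len j = word j mod 2 ^ word_len j) :: nat)"
  have n: "n > 0" by (simp add: n_def repeats_pos)
  have word_test: "word_test j (bit v) = of_bool (v mod 2 ^ word_len j = word j mod 2 ^ word_len j)" for v
  proof -
    have "bit v \<in> cylinder (word_len j) (word j) \<longleftrightarrow> take_bit (word_len j) v = take_bit (word_len j) (word j)"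
      by (auto simp: cylinder_def bit_eq_iff bit_take_bit_iff)
    then show ?thesis by (simp add: word_test_def take_bit_eq_mod indicator_def)
  qed
  have diff: "real (a - b) = max 0 (real a - real b)" for a b by (cases "b \<le> a") auto
  \<comment> \<open>the integer divisions in the recursion are exact, all quantities being powers of two\<close>
  have d1: "real (denom j div 2 ^ Suc j) = denom j / 2 ^ Suc j"
  proof -
    have "denom j = 2 ^ Suc (2 * (j * (j + 3)))" by (simp add: denom_def window_def power_mult)
    then have "2 ^ Suc j dvd denom j" by (simp only:) (intro le_imp_power_dvd, simp)
    then show ?thesis by (simp add: real_of_nat_div)
  qed
  have d2: "real (n div 2 ^ word_len j) = n / 2 ^ word_len j"
  proof -
    have "(4 :: nat) ^ k = 2 ^ (2 * k)" for k by (simp add: power_mult)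
    then have "n = 2 ^ (2 * (2 * j + 4))" by (simp only: n_def repeats_def)
    then have "2 ^ word_len j dvd n" using word_len_le[of j] by (simp only:) (intro le_imp_power_dvd, simp)
    then show ?thesis by (simp add: real_of_nat_div)
  qed
  have d3: "real (denom (Suc j) div 4 ^ Suc j) = denom (Suc j) / 4 ^ Suc j"
  proof -
    have "4 ^ Suc j dvd window (Suc j)" unfolding window_def by (intro le_imp_power_dvd) simp
    then have "4 ^ Suc j dvd denom (Suc j)" unfolding denom_def by (rule dvd_mult)
    then show ?thesis by (simp only: real_of_nat_div of_nat_power of_nat_numeral)
  qed
  have "real (stage_num (Suc j) u) = max 0 (denom j * \<sigma> + denom j / 2 ^ Suc j * max 0 (\<tau> - n / 2 ^ word_len j) - denom (Suc j) / 4 ^ Suc j)"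
    by (simp only: stage_num.simps diff of_nat_add of_nat_mult d1 d2 d3 n_def[symmetric] \<tau>_def[symmetric])
       (simp add: Suc.IH \<sigma>_def sum_distrib_left)
  also have "\<dots> = max 0 (denom (Suc j) * (\<sigma> / n + max 0 (\<tau> / n - 1 / 2 ^ word_len j) / 2 ^ Suc j - 1 / 4 ^ Suc j))"
  proof -
    have "max 0 (\<tau> - n / 2 ^ word_len j) = n * max 0 (\<tau> / n - 1 / 2 ^ word_len j)"
      using n by (simp add: max_mult_distrib_left right_diff_distrib)
    then show ?thesis
      using n by (simp add: denom_Suc n_def[symmetric] right_diff_distrib distrib_left mult_ac)
  qed
  also have "\<dots> = denom (Suc j) * max 0 (\<sigma> / n + max 0 (\<tau> / n - 1 / 2 ^ word_len j) / 2 ^ Suc j - 1 / 4 ^ Suc j)"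
    by (simp add: max_mult_distrib_left)
  also have "max 0 (\<sigma> / n + max 0 (\<tau> / n - 1 / 2 ^ word_len j) / 2 ^ Suc j - 1 / 4 ^ Suc j) = stage (Suc j) (bit u)"
    by (simp add: block_avg_def shift_bit \<sigma>_def \<tau>_def n_def word_test)
  finally show ?case .
qed simp

lemma stage_num_le: "stage_num j u \<le> denom j"
proof -
  have "real (denom j) * stage j (bit u) \<le> real (denom j) * 1"
    using stage_le_1[of j "bit u"] by (intro mult_left_mono) auto
  then show ?thesis using stage_num_eq[of j u] by linarith
qed

lemma of_rat_increment: "of_rat (rat_increment j u) = increment j (bit u)"
proof -
  have "of_rat (rat_increment j u) = real (stage_num (Suc j) u) / denom (Suc j)
      - (\<Sum>i<repeats j. real (stage_num j (u div 2 ^ (window j * i)))) / denom (Suc j)"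
    by (simp add: rat_increment_def of_rat_divide of_rat_diff diff_divide_distrib of_rat_sum del: stage_num.simps)
  also have "real (stage_num (Suc j) u) / denom (Suc j) = stage (Suc j) (bit u)"
    using denom_pos[of "Suc j"] by (simp add: stage_num_eq del: stage_num.simps stage.simps)
  also have "(\<Sum>i<repeats j. real (stage_num j (u div 2 ^ (window j * i)))) / denom (Suc j)
      = block_avg (window j) (repeats j) (stage j) (bit u)"
    using denom_pos[of j]
    by (simp add: stage_num_eq block_avg_def shift_bit denom_Suc flip: sum_distrib_left)
  finally show ?thesis by (simp add: increment_def)
qed

lemma computable_params:
  assumes "computable n f"
  shows "computable n (\<lambda>xs. repeats (f xs))" "computable n (\<lambda>xs. window (f xs))"
    "computable n (\<lambda>xs. denom (f xs))" "computable n (\<lambda>xs. spread (f xs))"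
    "computable n (\<lambda>xs. word (f xs))" "computable n (\<lambda>xs. word_len (f xs))"
  unfolding repeats_def window_def denom_def spread_def word_def word_len_def
  by (intro computable_intros computable_floor_log assms)+

lemma digit_of_sum:
  assumes "i < n" "\<And>j. j < n \<Longrightarrow> v j < (b::nat)"
  shows "(\<Sum>j<n. v j * b ^ j) div b ^ i mod b = v i"
  using assms
proof (induction n arbitrary: i v)
  case (Suc n)
  have b: "b > 0" using Suc.prems(2)[of 0] by simp
  have split: "(\<Sum>j<Suc n. v j * b ^ j) = v 0 + b * (\<Sum>j<n. v (Suc j) * b ^ j)"
    by (simp add: sum.lessThan_Suc_shift sum_distrib_left mult_ac del: sum.lessThan_Suc)
  show ?case
  proof (cases i)
    case 0
    then show ?thesis using split Suc.prems(2)[of 0] by simp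
  next
    case (Suc i')
    have "(\<Sum>j<Suc n. v j * b ^ j) div b ^ i = (\<Sum>j<n. v (Suc j) * b ^ j) div b ^ i'"
      using b Suc.prems(2)[of 0] unfolding split Suc power_Suc div_mult2_eq by simp
    then show ?thesis
      using Suc.IH[of i' "\<lambda>j. v (Suc j)"] Suc.prems Suc by simp
  qed
qed simp

definition digit :: "nat \<Rightarrow> nat \<Rightarrow> nat \<Rightarrow> nat" where
  "digit b t i = t div b ^ i mod b"

text \<open>
  The recursion for \<open>stage_num (j+1) u\<close> needs \<open>stage_num j\<close> at several arguments up to \<open>u\<close>, which is not
  of the form of a primitive recursion in \<open>j\<close>.  It becomes one when the whole table of values at arguments below \<open>z\<close> is
  kept as one number, the values being its digits in base \<open>z\<close>; a single parameter \<open>z\<close> serves as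
  length of the table and as base.
\<close>

definition stage_table :: "nat \<Rightarrow> nat \<Rightarrow> nat" where
  "stage_table z j = (\<Sum>u<z. stage_num j u * z ^ u)"

lemma digit_stage_table:
  assumes "u < z" "denom j < z"
  shows "digit z (stage_table z j) u = stage_num j u"
  unfolding digit_def stage_table_def
  using assms stage_num_le[of j] by (intro digit_of_sum) (auto intro: le_less_trans)

definition table_step :: "nat \<Rightarrow> nat \<Rightarrow> nat \<Rightarrow> nat \<Rightarrow> nat" where
  "table_step z j t u =
    (\<Sum>i<repeats j. digit z t (u div 2 ^ (window j * i)))
    + (denom j div 2 ^ Suc j) *
      ((\<Sum>i<repeats j. of_bool (u div 2 ^ (window j * i) mod 2 ^ word_len j = word j mod 2 ^ word_len j))
         - repeats j div 2 ^ word_len j)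
    - denom (Suc j) div 4 ^ Suc j"

lemma stage_table_rec:
  assumes "denom j < z"
  shows "stage_table z j = rec_nat 0 (\<lambda>j t. \<Sum>u<z. table_step z j t u * z ^ u) j"
  using assms
proof (induction j)
  case 0
  then show ?case by (simp add: stage_table_def)
next
  case (Suc j)
  have z: "denom j < z"
    using Suc.prems window_mono[of j "Suc j"] by (simp add: denom_def)
  have "table_step z j (stage_table z j) u = stage_num (Suc j) u" if "u < z" for u
  proof -
    have "u div 2 ^ (window j * i) < z" for i
      using that by (meson div_le_dividend le_less_trans)
    then show ?thesis
      by (simp add: table_step_def digit_stage_table z)
  qed
  then show ?case
    using Suc.IH[OF z] by (simp add: stage_table_def)
qed

text \<open>
  A table with \<open>z = denom j + u + 1\<close> is long enough to contain the argument \<open>u\<close>, and its base exceeds all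
  values that occur up to stage \<open>j\<close>.
\<close>

lemma computable_stage_num:
  assumes "computable n f" "computable n g" shows "computable n (\<lambda>xs. stage_num (f xs) (g xs))"
proof (rule computable_comp2[OF _ assms, where f=stage_num])
  let ?z = "\<lambda>j u. Suc (denom j + u)"
  have step: "computable 4 (\<lambda>xs. table_step (xs ! 3) (xs ! 1) (xs ! 2) (xs ! 0))"
    unfolding table_step_def digit_def
    by (intro computable_intros computable_params computable_div computable_mod computable_of_bool_eq
        computable_sum[where g="\<lambda>ys. ys ! 3 div (ys ! 4) ^ (ys ! 1 div 2 ^ (window (ys ! 2) * ys ! 0)) mod ys ! 4"]
        computable_sum[where g="\<lambda>ys. of_bool (ys ! 1 div 2 ^ (window (ys ! 2) * ys ! 0) mod 2 ^ word_len (ys ! 2)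
           = word (ys ! 2) mod 2 ^ word_len (ys ! 2))"]) simp_all
  have step5: "computable (Suc (Suc (Suc 2))) (\<lambda>xs. table_step (xs ! 3) (xs ! 1) (xs ! 2) (xs ! 0))"
    using computable_comp[of "map (\<lambda>i xs. xs ! i) [0,1,2,3]" "\<lambda>xs. table_step (xs ! 3) (xs ! 1) (xs ! 2) (xs ! 0)" "Suc (Suc (Suc 2))"]
      step by (simp add: computable_intros numeral_eq_Suc)
  have row4: "computable (Suc (Suc 2)) (\<lambda>xs. \<Sum>u<xs!2. table_step (xs ! 2) (xs ! 0) (xs ! 1) u * (xs ! 2) ^ u)"
    by (intro computable_sum[where g="\<lambda>ys. table_step (ys ! 3) (ys ! 1) (ys ! 2) (ys ! 0) * (ys ! 3) ^ (ys ! 0)"]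
       computable_proj computable_mult computable_power step5) simp_all
  have "computable 2 (\<lambda>xs. rec_nat 0 (\<lambda>j t. \<Sum>u<xs!0. table_step (xs ! 0) j t u * (xs ! 0) ^ u) (xs ! 1))"
    by (intro computable_rec[where h="\<lambda>xs. \<Sum>u<xs!2. table_step (xs ! 2) (xs ! 0) (xs ! 1) u * (xs ! 2) ^ u"]
       computable_const computable_proj row4) simp_all
  note table = computable_comp2[where f="\<lambda>z j. rec_nat 0 (\<lambda>j t. \<Sum>u<z. table_step z j t u * z ^ u) j", OF this]
  have "computable 2 (\<lambda>xs. (\<lambda>z. digit z
      (rec_nat 0 (\<lambda>j t. \<Sum>u<z. table_step z j t u * z ^ u) (xs ! 0)) (xs ! 1)) (?z (xs ! 0) (xs ! 1)))"
    unfolding digit_def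
    by (intro computable_div computable_mod table computable_intros computable_params) simp_all
  moreover have "(\<lambda>z. digit z (rec_nat 0 (\<lambda>j t. \<Sum>u<z. table_step z j t u * z ^ u) j) u) (?z j u) = stage_num j u" for j u
    using stage_table_rec[of j "?z j u"] digit_stage_table[of u "?z j u" j] by simp
  ultimately show "computable 2 (\<lambda>ys. stage_num (ys ! 0) (ys ! 1))" by simp
qed

lemma computable_minus_one_power:
  assumes "computable n f" shows "computable_rat n (\<lambda>xs. (- 1) ^ f xs)"
proof -
  have "(- 1 :: rat) ^ m = of_nat 1 - of_nat (2 * (m mod 2))" for m
    by (cases "even m") (auto simp: odd_iff_mod_2_eq_one)
  then show ?thesis
    using assms by (simp only: computable_rat_diff computable_rat_of_nat computable_intros computable_mod)
qed

lemma computable_walsh_exponent: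
  assumes "computable n f" "computable n g" shows "computable n (\<lambda>xs. walsh_exponent (f xs) (g xs))"
proof (rule computable_comp2[OF _ assms, where f=walsh_exponent])
  show "computable 2 (\<lambda>ys. walsh_exponent (ys ! 0) (ys ! 1))"
    unfolding walsh_exponent_def
    by (intro computable_sum[where g="\<lambda>ys. (ys ! 1 div 2 ^ (ys ! 0) mod 2) * (ys ! 2 div 2 ^ (ys ! 0) mod 2)"]
       computable_intros computable_div computable_mod) simp_all
qed

lemma computable_rat_comp:
  assumes f: "computable_rat (length gs) f" and gs: "\<forall>g\<in>set gs. computable n g"
  shows "computable_rat n (\<lambda>xs. f (map (\<lambda>g. g xs) gs))"
proof -
  obtain p q d where "computable (length gs) p" "computable (length gs) q" "computable (length gs) d"
    and f: "\<forall>xs. length xs = length gs \<longrightarrow> d xs \<noteq> 0 \<and> f xs = (of_nat (p xs) - of_nat (q xs)) / of_nat (d xs)"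
    using f unfolding computable_rat_def by blast
  then have "computable n (\<lambda>xs. p (map (\<lambda>g. g xs) gs))" "computable n (\<lambda>xs. q (map (\<lambda>g. g xs) gs))"
    "computable n (\<lambda>xs. d (map (\<lambda>g. g xs) gs))"
    using gs by (auto intro: computable_comp)
  then show ?thesis using f by (intro computable_ratI) auto
qed

lemma computable_rat_rat_increment:
  assumes "computable n f" "computable n g"
  shows "computable_rat n (\<lambda>xs. rat_increment (f xs) (g xs))"
proof -
  have "computable_rat 2 (\<lambda>xs. rat_increment (xs ! 0) (xs ! 1))"
    unfolding rat_increment_def
    by (intro computable_rat_divide computable_rat_diff computable_rat_of_nat computable_stage_num
       computable_sum[where g="\<lambda>ys. stage_num (ys ! 1) (ys ! 2 div 2 ^ (window (ys ! 1) * ys ! 0))"]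
       computable_intros computable_params computable_div) (simp_all add: denom_def window_def)
  then show ?thesis
    using computable_rat_comp[of "[f, g]" "\<lambda>xs. rat_increment (xs ! 0) (xs ! 1)" n] assms
    by (simp add: numeral_2_eq_2)
qed

lemma computable_rat_increment_coeff:
  assumes "computable n f" "computable n g" "computable n h"
  shows "computable_rat n (\<lambda>xs. increment_coeff (f xs) (g xs) (h xs))"
proof -
  have "computable_rat 3 (\<lambda>xs. increment_coeff (xs ! 0) (xs ! 1) (xs ! 2))"
    unfolding increment_coeff_def
    by (intro computable_rat_divide 
        computable_rat_sum[where g="\<lambda>xs. rat_increment (xs ! 2) (xs ! 0 div 2 ^ (xs ! 3)) * (-1) ^ walsh_exponent (xs ! 1) (xs ! 0)"]
        computable_rat_mult computable_rat_rat_increment computable_minus_one_power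
      computable_walsh_exponent computable_intros computable_div computable_params) simp_all
  then show ?thesis
    using computable_rat_comp[of "[f, g, h]" "\<lambda>xs. increment_coeff (xs ! 0) (xs ! 1) (xs ! 2)" n] assms
    by (simp add: numeral_2_eq_2 numeral_3_eq_3)
qed

lemma computable_rat_seq_potential_coeff: "computable_rat_seq potential_coeff"
proof -
  have "computable_rat 2
      (\<lambda>xs. (\<Sum>i<spread (xs ! 0). increment_coeff (xs ! 1) (xs ! 0) (xs ! 0 + i)) / of_nat (spread (xs ! 0)))"
    by (intro computable_rat_divide
         computable_rat_sum[where g="\<lambda>xs. increment_coeff (xs ! 2) (xs ! 1) (xs ! 1 + xs ! 0)"]
         computable_rat_increment_coeff computable_intros computable_params)
      (simp_all add: spread_def)
  then have "computable_rat 1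
      (\<lambda>xs. \<Sum>j<xs ! 0. (\<Sum>i<spread j. increment_coeff (xs ! 0) j (j + i)) / of_nat (spread j))"
    by (intro computable_rat_sum[where g="\<lambda>xs. (\<Sum>i<spread (xs ! 0).
          increment_coeff (xs ! 1) (xs ! 0) (xs ! 0 + i)) / of_nat (spread (xs ! 0))"] computable_proj)
      (simp_all add: numeral_2_eq_2)
  then have "computable_rat 1 (\<lambda>xs. of_nat 0
      - (\<Sum>j<xs ! 0. (\<Sum>i<spread j. increment_coeff (xs ! 0) j (j + i)) / of_nat (spread j)))"
    by (intro computable_rat_diff computable_rat_of_nat computable_const)
  then show ?thesis
    unfolding computable_rat_seq_iff potential_coeff_def by simp
qed
lemma walsh_sign: "walsh k (bit u) = (- 1) ^ walsh_exponent k u"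
proof -
  have b: "of_bool (bit a i) = a div 2 ^ i mod 2" for a i :: nat
    by (simp add: bit_iff_odd odd_iff_mod_2_eq_one)
  have "(\<Sum>i | bit k i. of_bool (bit u i)) = (\<Sum>i<k. of_bool (bit k i) * of_bool (bit u i) :: nat)"
    by (rule sum.mono_neutral_cong_left) (auto dest: bit_less)
  then show ?thesis by (simp only: walsh_def walsh_exponent_def b)
qed

lemma of_rat_increment_coeff:
  "of_rat (increment_coeff k j m) = walsh_coeff k (\<lambda>x. increment j ((shift ^^ m) x))"
proof -
  let ?P = "k + m + window (Suc j)"
  have "k < 2 ^ ?P" using less_exp[of k] by (rule less_le_trans) (auto intro: power_increasing)
  moreover have "depends_on ?P (\<lambda>x. increment j ((shift ^^ m) x))"
    by (rule depends_on_mono[OF depends_on_shift[OF depends_on_increment]]) simp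
  ultimately have "walsh_coeff k (\<lambda>x. increment j ((shift ^^ m) x))
      = (\<Sum>u<(2 :: nat) ^ ?P. increment j (bit (u div 2 ^ m)) * walsh k (bit u)) / 2 ^ ?P"
    unfolding walsh_coeff_def by (simp only: mean_eq[OF depends_on_mult_walsh] shift_bit)
  then show ?thesis
    by (simp add: increment_coeff_def of_rat_divide of_rat_sum of_rat_mult of_rat_power of_rat_increment walsh_sign)
qed

text \<open>
  The minus sign appears since the function with the Bernoulli measure as maximizing measure is the
  negative of the potential.
\<close>

lemma of_rat_potential_coeff:
  assumes "1 \<le> k" shows "of_rat (potential_coeff k) = - walsh_coeff k potential"
  unfolding walsh_coeff_potential[OF assms order_refl] potential_coeff_def
  by (simp add: of_rat_diff of_rat_divide of_rat_sum of_rat_minus of_rat_increment_coeff walsh_coeff_spread_increment)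

section \<open>The theorem\<close>

lemma uniform_limit_walsh_series:
  "uniform_limit UNIV (\<lambda>K x. \<Sum>k = 1..K. of_rat (potential_coeff k) * walsh k x) (\<lambda>x. - potential x) sequentially"
proof (rule uniform_limitI)
  fix e :: real assume e: "e > 0"
  have "(\<lambda>J. 3 / 2 ^ J :: real) \<longlonglongrightarrow> 0" by real_asymp
  then have "\<forall>\<^sub>F J in sequentially. (3 / 2 ^ J :: real) < e" using e by (rule order_tendstoD(2))
  then obtain J where J: "3 / 2 ^ J < e" by (auto simp: eventually_sequentially)
  obtain R where R: "depends_on R (partial_potential J)" using depends_on_partial_potential by blast
  have eq: "(\<Sum>k = 1..K. of_rat (potential_coeff k) * walsh k x) = - walsh_sum (Suc K) potential x" for K x
  proof -
    \<comment> \<open>the constant term is absent because the potential has mean zero\<close>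
    have c0: "walsh_coeff 0 potential = 0" by (simp add: walsh_coeff_def walsh_0 mean_potential)
    have "walsh_sum (Suc K) potential x = (\<Sum>k = 1..K. walsh_coeff k potential * walsh k x)"
      unfolding walsh_sum_def by (rule sum.mono_neutral_right) (auto simp: c0 Suc_le_eq)
    then show ?thesis by (simp add: of_rat_potential_coeff flip: sum_negf)
  qed
  show "\<forall>\<^sub>F K in sequentially. \<forall>x\<in>UNIV. dist (\<Sum>k = 1..K. of_rat (potential_coeff k) * walsh k x) (- potential x) < e"
    using eventually_ge_at_top[of "2 ^ R"]
  proof eventually_elim
    case (elim K)
    show ?case
    proof
      fix x
      have "\<bar>walsh_sum (Suc K) potential x - potential x\<bar> < e"
        using walsh_series_error[OF R elim, of x] J by linarith
      then show "dist (\<Sum>k = 1..K. of_rat (potential_coeff k) * walsh k x) (- potential x) < e"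
        unfolding eq dist_real_def by linarith
    qed
  qed
qed

theorem theorem3:
  shows "\<exists>(c :: nat \<Rightarrow> rat) (F :: (nat \<Rightarrow> bool) \<Rightarrow> real).
    continuous_on UNIV F \<and>
    (\<forall>x. (\<lambda>k. of_rat (c (Suc k)) * walsh (Suc k) x) sums F x) \<and>
    uniform_limit UNIV (\<lambda>K x. \<Sum>k = 1..K. of_rat (c k) * walsh k x) F sequentially \<and>
    (\<forall>\<mu>. maximizing F \<mu> \<longleftrightarrow> \<mu> = bernoulli_half) \<and>
    computable_rat_seq c"
proof (intro exI conjI allI)
  show "continuous_on UNIV (\<lambda>x. - potential x)"
    by (intro continuous_on_minus continuous_potential)
  show "(\<lambda>k. of_rat (potential_coeff (Suc k)) * walsh (Suc k) x) sums (- potential x)" for x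
    using tendsto_uniform_limitI[OF uniform_limit_walsh_series UNIV_I, of x]
    by (simp add: sums_def sum.atLeast1_atMost_eq)
qed (rule uniform_limit_walsh_series maximizing_iff computable_rat_seq_potential_coeff)+

end
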